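(* For any odd integers $k \geq 3$ and $\ell \geq 5$, the edges of the bumpy wheel $BW_{k,\ell}$ cannot be partitioned into $n = \frac{k\ell+1}{2}$ plane spanning trees.
   Context: A geometric graph is a graph drawn in the plane whose vertices are points in general position and whose edges are straight-line segments; it is plane if no two edges share a point of their relative interiors. A partition of a graph is a set of edge-disjoint subgraphs whose union is the graph; a spanning tree is a tree containing all vertices. For odd integers $k,\ell\ge 3$, the bumpy wheel $BW_{k,\ell}$ is the complete geometric graph on the following set of $k\ell+1$ points: take a regular $k$-gon with center $v_0$ and replace each of its $k$ vertices by a group of $\ell$ points that are $\varepsilon$-close for a sufficiently small $\varepsilon>0$, such that all $k\ell$ points other than $v_0$ lie on the convex hull (in convex position), $v_0$ is the only interior point, and the convex hull of any $\frac{k+1}{2}$ consecutive groups does not contain $v_0$. *)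

theory Defs
  imports "HOL-Analysis.Analysis" "HOL-Library.Disjoint_Sets"
begin

text \<open>
  Graphs are simple and undirected: a vertex set \<open>V\<close> and a set of edges, an edge being the
  two-element set of its endpoints. In a geometric graph the vertices are points, and the drawing
  of the edge \<open>e\<close> is the segment \<open>convex hull e\<close>.
\<close>

definition complete_edges :: "'a set \<Rightarrow> 'a set set" where
  "complete_edges V = {e. e \<subseteq> V \<and> card e = 2}"

definition graph_connected :: "'a set \<Rightarrow> 'a set set \<Rightarrow> bool" where
  "graph_connected V E \<longleftrightarrow> V \<noteq> {} \<and> (\<forall>u\<in>V. \<forall>v\<in>V. (u, v) \<in> {(x, y). {x, y} \<in> E}\<^sup>*)"

definition graph_cycle :: "'a set set \<Rightarrow> 'a list \<Rightarrow> bool" where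
  "graph_cycle E c \<longleftrightarrow>
     3 \<le> length c \<and> distinct c \<and>
     (\<forall>i<length c. {c ! i, c ! (Suc i mod length c)} \<in> E)"

text \<open>
  A spanning subgraph has all of \<open>V\<close> as its vertex set, so it is given by its edge set alone.
\<close>

definition spanning_tree :: "'a set \<Rightarrow> 'a set set \<Rightarrow> bool" where
  "spanning_tree V T \<longleftrightarrow>
     T \<subseteq> complete_edges V \<and> graph_connected V T \<and> (\<nexists>c. graph_cycle T c)"

definition plane_edges :: "'a::euclidean_space set set \<Rightarrow> bool" where
  "plane_edges E \<longleftrightarrow>
     (\<forall>e\<in>E. \<forall>f\<in>E. e \<noteq> f \<longrightarrow>
        rel_interior (convex hull e) \<inter> rel_interior (convex hull f) = {})"

definition plane_spanning_tree :: "'a::euclidean_space set \<Rightarrow> 'a set set \<Rightarrow> bool" where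
  "plane_spanning_tree V T \<longleftrightarrow> spanning_tree V T \<and> plane_edges T"

definition general_position :: "'a::euclidean_space set \<Rightarrow> bool" where
  "general_position V \<longleftrightarrow> (\<forall>S\<subseteq>V. card S = 3 \<longrightarrow> \<not> collinear S)"

text \<open>
  The plane is \<^typ>\<open>complex\<close>. The vertices of the regular \<open>k\<close>-gon with centre \<open>v\<close>, circumradius
  \<open>r\<close> and rotation angle \<open>\<phi>\<close> are \<open>ngon_vertex k v r \<phi> i\<close> for \<open>i < k\<close>, in counterclockwise order.
\<close>

definition ngon_vertex :: "nat \<Rightarrow> complex \<Rightarrow> real \<Rightarrow> real \<Rightarrow> nat \<Rightarrow> complex" where
  "ngon_vertex k v r \<phi> i = v + rcis r (\<phi> + 2 * pi * real i / real k)"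

definition bumpy_wheel_points :: "nat \<Rightarrow> complex \<Rightarrow> (nat \<Rightarrow> complex set) \<Rightarrow> complex set" where
  "bumpy_wheel_points k v G = insert v (\<Union>i<k. G i)"

text \<open>
  \<open>G 0, \<dots>, G (k - 1)\<close> are the groups of a bumpy wheel with parameter \<open>\<epsilon>\<close>. That \<open>\<epsilon>\<close> be
  sufficiently small is not part of this predicate and has to be required where it is used.
  The \<open>extreme_point_of\<close> clause says that the points other than the centre are in convex position
  and on the hull; the last clause treats \<open>(k + 1) div 2\<close> cyclically consecutive groups starting
  with \<open>G i\<close>.
\<close>

definition bumpy_wheel ::
  "nat \<Rightarrow> nat \<Rightarrow> complex \<Rightarrow> real \<Rightarrow> real \<Rightarrow> real \<Rightarrow> (nat \<Rightarrow> complex set) \<Rightarrow> bool" where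
  "bumpy_wheel k l v r \<phi> \<epsilon> G \<longleftrightarrow>
     (let V = bumpy_wheel_points k v G in
       (\<forall>i<k. card (G i) = l \<and> G i \<subseteq> cball (ngon_vertex k v r \<phi> i) \<epsilon>) \<and>
       disjoint_family_on G {..<k} \<and>
       general_position V \<and>
       (\<forall>i<k. \<forall>p\<in>G i. p extreme_point_of (convex hull V)) \<and>
       V \<inter> interior (convex hull V) = {v} \<and>
       (\<forall>i<k. v \<notin> convex hull (\<Union>t<(k + 1) div 2. G ((i + t) mod k))))"

end

theory Submission
  imports Defs
begin

text \<open>
  Write \<open>k = 2h + 1\<close>. Call an edge between opposite groups \<open>g\<close> and \<open>g + h\<close> long if its span, the
  number of steps along the hull on the side away from the centre, is at least \<open>hl\<close>, and a diagonal
  if its span is exactly \<open>hl\<close>. Two long edges from the same group \<open>g\<close> in a plane tree are nested; from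
  different groups they can only coexist if they meet in a common apex group, and three families
  would close a triangle. Hence a tree has at most two diagonals; as there are \<open>kl = 2n - 1\<close> of
  them, exactly one tree \<open>T\<^sub>0\<close> has one diagonal and all others have two. Comparing the outermost long
  edges with the spokes that avoid them, and using acyclicity, (long edges) + (spokes) is at most
  \<open>l + 2\<close> for a tree with two diagonals and at most \<open>hl + l + 1\<close> for \<open>T\<^sub>0\<close>. Summed over all trees both
  sides agree, so equality holds for each tree.

  Thus \<open>T\<^sub>0\<close> has long edges from one group \<open>g\<^sub>0\<close> only, and it contains all spokes to the groups
  outside \<open>g\<^sub>0, \<dots>, g\<^sub>0 + h\<close>. A tree whose apex group is one of those therefore has no spoke at its apex,
  and equality forces it to use one of the two spokes at the gap opposite to the apex group: there are
  at most two such trees per apex group. Each group is the start of the diagonals of exactly \<open>l\<close>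
  trees; applied to \<open>g\<^sub>0 - h\<close> and \<open>g\<^sub>0 + h\<close>, this shows that the apex groups \<open>g\<^sub>0\<close> and \<open>g\<^sub>0 + h\<close> each serve at least \<open>l - 2\<close> trees; all of these, and \<open>T\<^sub>0\<close>,
  have a diagonal starting in \<open>g\<^sub>0\<close>. So \<open>2(l - 2) + 1 \<le> l\<close>, contradicting \<open>l \<ge> 5\<close>.
\<close>

subsection \<open>Plane forests on a wheel of point groups\<close>

lemma sum_card_Int_partition_on:
  assumes "partition_on A P" "finite A" "S \<subseteq> A"
  shows "(\<Sum>T\<in>P. card (T \<inter> S)) = card S"
proof -
  have fP: "finite P" using assms finite_elements by blast
  have "card (\<Union>T\<in>P. T \<inter> S) = (\<Sum>T\<in>P. card (T \<inter> S))"
  proof (rule card_UN_disjoint)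
    show "\<forall>T\<in>P. finite (T \<inter> S)"
      using assms finite_subset by blast
    show "\<forall>T\<in>P. \<forall>U\<in>P. T \<noteq> U \<longrightarrow> (T \<inter> S) \<inter> (U \<inter> S) = {}"
      using assms(1) unfolding partition_on_def disjoint_def by blast
  qed (fact fP)
  moreover have "(\<Union>T\<in>P. T \<inter> S) = S"
    using assms unfolding partition_on_def by blast
  ultimately show ?thesis by simp
qed

lemma graph_cycle_triangle:
  assumes "distinct [a, b, c]" "{a, b} \<in> E" "{b, c} \<in> E" "{c, a} \<in> E"
  shows "graph_cycle E [a, b, c]"
  unfolding graph_cycle_def
proof (intro conjI allI impI)
  fix i assume "i < length [a, b, c]"
  then consider "i = 0" | "i = 1" | "i = 2" by fastforce
  then show "{[a, b, c] ! i, [a, b, c] ! (Suc i mod length [a, b, c])} \<in> E"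
    by cases (use assms in simp_all)
qed (use assms in simp_all)

lemma graph_cycle_square:
  assumes "distinct [a, b, c, d]" "{a, b} \<in> E" "{b, c} \<in> E" "{c, d} \<in> E" "{d, a} \<in> E"
  shows "graph_cycle E [a, b, c, d]"
  unfolding graph_cycle_def
proof (intro conjI allI impI)
  fix i assume "i < length [a, b, c, d]"
  then consider "i = 0" | "i = 1" | "i = 2" | "i = 3" by fastforce
  then show "{[a, b, c, d] ! i, [a, b, c, d] ! (Suc i mod length [a, b, c, d])} \<in> E"
    by cases (use assms in simp_all)
qed (use assms in simp_all)

lemma card_triangular: "2 * card {(x, y). x \<le> y \<and> y < (l::nat)} = l * (l + 1)"
proof -
  have "{(x, y). x \<le> y \<and> y < l} = prod.swap ` (SIGMA y:{..<l}. {..y})"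
    by (force simp: image_iff)
  then have "card {(x, y). x \<le> y \<and> y < l} = card (SIGMA y:{..<l}. {..y})"
    by (simp add: card_image)
  also have "\<dots> = (\<Sum>y<l. Suc y)" by simp
  finally have *: "card {(x, y). x \<le> y \<and> y < l} = (\<Sum>y<l. Suc y)" .
  have "2 * (\<Sum>y<l. Suc y) = l * (l + 1)" by (induction l) auto
  with * show ?thesis by simp
qed

text \<open>
  \<open>pt g x\<close> is the \<open>x\<close>-th point, counterclockwise, of group \<open>g mod k\<close>; \<open>R p q\<close> stands for \<open>q\<close> lying within
  the open half turn counterclockwise of \<open>p\<close> as seen from the centre \<open>v\<close>.
\<close>

locale wheel_forests =
  fixes k l h :: nat and pt :: "int \<Rightarrow> nat \<Rightarrow> 'a" and v :: 'a
    and R :: "'a \<Rightarrow> 'a \<Rightarrow> bool" and \<T> :: "'a set set set"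
  assumes k_eq: "k = 2 * h + 1" and h_pos: "1 \<le> h" and l_pos: "0 < l"
    and pt_eq_iff: "\<lbrakk>x < l; y < l\<rbrakk> \<Longrightarrow>
          pt g x = pt g' y \<longleftrightarrow> g mod int k = g' mod int k \<and> x = y"
    and pt_neq_v: "x < l \<Longrightarrow> pt g x \<noteq> v"
    and R_groups: "\<lbrakk>0 < t; t \<le> int h; x < l; y < l\<rbrakk> \<Longrightarrow> R (pt g x) (pt (g + t) y)"
    and R_within: "\<lbrakk>x < y; y < l\<rbrakk> \<Longrightarrow> R (pt g x) (pt g y)"
    and part: "partition_on (complete_edges (insert v {pt g x |g x. x < l})) \<T>"
    and card_\<T>: "2 * card \<T> = k * l + 1"
    and acyclic: "T \<in> \<T> \<Longrightarrow> \<not> graph_cycle T cyc"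
    and chords: "\<lbrakk>T \<in> \<T>; {a, b} \<in> T; {c, d} \<in> T; R a c; R c b; R a b; R b d; R c d\<rbrakk> \<Longrightarrow> False"
    and spoke: "\<lbrakk>T \<in> \<T>; {a, b} \<in> T; {v, w} \<in> T; R a w; R w b; R a b\<rbrakk> \<Longrightarrow> False"
begin

section \<open>Group indices modulo \<open>k\<close>\<close>

abbreviation same_group :: "int \<Rightarrow> int \<Rightarrow> bool" (infix "\<cong>" 50) where
  "g \<cong> g' \<equiv> int k dvd g - g'"

lemma pt_eq: "\<lbrakk>x < l; y < l\<rbrakk> \<Longrightarrow> pt g x = pt g' y \<longleftrightarrow> g \<cong> g' \<and> x = y"
  by (simp add: pt_eq_iff mod_eq_dvd_iff)

lemma not_dvd_small: "0 < i \<Longrightarrow> i < int k \<Longrightarrow> \<not> int k dvd i"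
  by (simp add: zdvd_not_zless)

lemma not_same_group: "0 < \<bar>g - g'\<bar> \<Longrightarrow> \<bar>g - g'\<bar> < int k \<Longrightarrow> \<not> g \<cong> g'"
  using not_dvd_small[of "\<bar>g - g'\<bar>"] by simp

lemma same_group_sym: "g \<cong> g' \<Longrightarrow> g' \<cong> g"
  by (metis dvd_minus_iff minus_diff_eq)

lemma obtain_offset:
  obtains t where "0 \<le> t" "t < int k" "g' \<cong> g + t"
proof
  have "0 < int k" using k_eq by simp
  then show "0 \<le> (g' - g) mod int k" "(g' - g) mod int k < int k" by auto
  have "int k dvd (g' - g) - (g' - g) mod int k" by (rule dvd_minus_mod)
  then show "g' \<cong> g + (g' - g) mod int k" by (simp add: algebra_simps)
qed

section \<open>Long edges, diagonals and spokes: unique indexing and total numbers\<close>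

definition long :: "int \<Rightarrow> nat \<Rightarrow> nat \<Rightarrow> 'a set" where
  "long g x y = {pt g x, pt (g + int h) y}"

lemma long_cong: "g \<cong> g' \<Longrightarrow> x < l \<Longrightarrow> y < l \<Longrightarrow> long g x y = long g' x y"
  by (simp add: long_def pt_eq doubleton_eq_iff)

text \<open>The starting group can be read off from the unordered edge: an edge that also starts at
  its other end would force \<open>k\<close> to divide \<open>2 * h\<close>, although
  \<open>0 < 2 * h < k\<close>.\<close>

lemma long_eq_iff:
  assumes "x < l" "y < l" "x' < l" "y' < l"
  shows "long g x y = long g' x' y' \<longleftrightarrow> g \<cong> g' \<and> x = x' \<and> y = y'"
proof
  assume "long g x y = long g' x' y'"
  then consider "pt g x = pt g' x'" "pt (g + int h) y = pt (g' + int h) y'"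
    | "pt g x = pt (g' + int h) y'" "pt (g + int h) y = pt g' x'"
    by (auto simp: long_def doubleton_eq_iff)
  then show "g \<cong> g' \<and> x = x' \<and> y = y'"
  proof cases
    case 2
    then have "g \<cong> g' + int h" "g + int h \<cong> g'" using assms by (auto simp: pt_eq)
    then have "int k dvd (g + int h - g') - (g - (g' + int h))" by (rule dvd_diff[rotated])
    then have "int k dvd 2 * int h" by (simp add: algebra_simps)
    then show ?thesis using not_dvd_small[of "2 * int h"] h_pos k_eq by simp
  qed (use assms in \<open>auto simp: pt_eq\<close>)
qed (use assms long_cong in auto)

text \<open>Counterclockwise along the hull there are \<open>h * l + y - x\<close> steps from
  \<open>pt g x\<close> to \<open>pt (g + int h) y\<close>. Thus \<open>x \<le> y\<close> selects
  the spans of at least \<open>h * l\<close>, and \<open>x = y\<close> selects the span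
  \<open>h * l\<close> itself.\<close>

definition Longs :: "'a set set" where "Longs = {long g x y |g x y. x \<le> y \<and> y < l}"
definition Diags :: "'a set set" where "Diags = {long g x x |g x. x < l}"
definition Spokes :: "'a set set" where "Spokes = {{v, pt g x} |g x. x < l}"

lemma residue: obtains g' where "g' \<in> {0..<int k}" "g \<cong> g'"
  using obtain_offset[of g 0] by (metis add_0 atLeastLessThan_iff)

lemma residues_eq: "g \<in> {0..<int k} \<Longrightarrow> g' \<in> {0..<int k} \<Longrightarrow> g \<cong> g' \<Longrightarrow> g = g'"
  using not_same_group[of g g'] by fastforce

lemma card_Longs: "2 * card Longs = k * (l * (l + 1))"
proof -
  let ?I = "{0..<int k} \<times> {(x, y). x \<le> y \<and> y < l}"
  let ?f = "\<lambda>(g, x, y). long g x y"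
  have "Longs = ?f ` ?I"
  proof
    show "Longs \<subseteq> ?f ` ?I"
    proof
      fix e assume "e \<in> Longs"
      then obtain g x y where e: "e = long g x y" "x \<le> y" "y < l" by (auto simp: Longs_def)
      obtain g' where g': "g' \<in> {0..<int k}" "g \<cong> g'" by (rule residue)
      have "e = ?f (g', x, y)" using e g' long_cong[of g g' x y] by simp
      moreover have "(g', x, y) \<in> ?I" using g' e by simp
      ultimately show "e \<in> ?f ` ?I" by (rule image_eqI)
    qed
  qed (auto simp: Longs_def)
  moreover have "inj_on ?f ?I"
  proof (rule inj_onI)
    fix p q assume pq: "p \<in> ?I" "q \<in> ?I" "?f p = ?f q"
    obtain g x y g' x' y' where p: "p = (g, x, y)" and q: "q = (g', x', y')"
      by (metis surj_pair)
    have "g \<cong> g' \<and> x = x' \<and> y = y'"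
      using pq p q long_eq_iff[of x y x' y' g g'] by simp
    then show "p = q" using residues_eq[of g g'] pq p q by simp
  qed
  ultimately have "card Longs = k * card {(x, y). x \<le> y \<and> y < l}"
    by (simp add: card_image card_cartesian_product)
  then show ?thesis using card_triangular[of l] by (simp add: algebra_simps)
qed

lemma card_Diags: "card Diags = k * l"
proof -
  let ?I = "{0..<int k} \<times> {..<l}"
  let ?f = "\<lambda>(g, x). long g x x"
  have "Diags = ?f ` ?I"
  proof
    show "Diags \<subseteq> ?f ` ?I"
    proof
      fix e assume "e \<in> Diags"
      then obtain g x where e: "e = long g x x" "x < l" by (auto simp: Diags_def)
      obtain g' where g': "g' \<in> {0..<int k}" "g \<cong> g'" by (rule residue)
      have "e = ?f (g', x)" using e g' long_cong[of g g' x x] by simp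
      moreover have "(g', x) \<in> ?I" using g' e by simp
      ultimately show "e \<in> ?f ` ?I" by (rule image_eqI)
    qed
  qed (auto simp: Diags_def)
  moreover have "inj_on ?f ?I"
  proof (rule inj_onI)
    fix p q assume pq: "p \<in> ?I" "q \<in> ?I" "?f p = ?f q"
    obtain g x g' x' where p: "p = (g, x)" and q: "q = (g', x')"
      by (metis surj_pair)
    have "g \<cong> g' \<and> x = x'"
      using pq p q long_eq_iff[of x x x' x' g g'] by simp
    then show "p = q" using residues_eq[of g g'] pq p q by simp
  qed
  ultimately show ?thesis by (simp add: card_image card_cartesian_product)
qed

text \<open>Spokes are indexed relative to a base group \<open>g\<close>, so that the ranges are free of wrap-around.\<close>

definition rad :: "'a set set \<Rightarrow> int \<Rightarrow> (nat \<times> nat) set" where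
  "rad T g = {(t, z). t < k \<and> z < l \<and> {v, pt (g + int t) z} \<in> T}"

lemma finite_rad: "finite (rad T g)"
  by (rule finite_subset[of _ "{..<k} \<times> {..<l}"]) (auto simp: rad_def)

lemma inj_on_spoke: "inj_on (\<lambda>(t, z). {v, pt (g + int t) z}) ({..<k} \<times> {..<l})"
proof (rule inj_onI, clarify)
  fix t z t' z' assume *: "t < k" "z < l" "t' < k" "z' < l"
    and "{v, pt (g + int t) z} = {v, pt (g + int t') z'}"
  then have "pt (g + int t) z = pt (g + int t') z'"
    using pt_neq_v by (auto simp: doubleton_eq_iff)
  then have "g + int t \<cong> g + int t'" "z = z'" using * by (auto simp: pt_eq)
  then show "t = t' \<and> z = z'" using not_same_group[of "g + int t" "g + int t'"] * by force
qed

lemma Spokes_eq: "Spokes = (\<lambda>(t, z). {v, pt (g + int t) z}) ` ({..<k} \<times> {..<l})"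
proof
  show "Spokes \<subseteq> (\<lambda>(t, z). {v, pt (g + int t) z}) ` ({..<k} \<times> {..<l})"
  proof
    fix e assume "e \<in> Spokes"
    then obtain g' z where e: "e = {v, pt g' z}" "z < l" by (auto simp: Spokes_def)
    obtain t where t: "0 \<le> t" "t < int k" "g' \<cong> g + t" by (rule obtain_offset)
    have "pt g' z = pt (g + int (nat t)) z" using e t by (simp add: pt_eq)
    then have "e = (\<lambda>(t, z). {v, pt (g + int t) z}) (nat t, z)" using e by simp
    moreover have "(nat t, z) \<in> {..<k} \<times> {..<l}" using t e by (simp add: nat_less_iff)
    ultimately show "e \<in> (\<lambda>(t, z). {v, pt (g + int t) z}) ` ({..<k} \<times> {..<l})"
      by (rule image_eqI)
  qed
qed (auto simp: Spokes_def)

lemma card_Spokes: "card Spokes = k * l"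
  using card_image[OF inj_on_spoke[of 0]] Spokes_eq[of 0] by (simp add: card_cartesian_product)

lemma card_rad: "card (rad T g) = card (T \<inter> Spokes)"
proof -
  let ?f = "\<lambda>(t, z). {v, pt (g + int t) z}"
  have "T \<inter> Spokes = ?f ` rad T g" unfolding Spokes_eq[of g] by (auto simp: rad_def)
  moreover have "inj_on ?f (rad T g)"
    by (rule inj_on_subset[OF inj_on_spoke]) (auto simp: rad_def)
  ultimately show ?thesis by (simp add: card_image)
qed

lemma long_compat:

  \<comment> \<open>Long edges and spokes that can coexist in one tree\<close>
  assumes T: "T \<in> \<T>" "long g x y \<in> T" "long g' x' y' \<in> T"
    and xy: "x \<le> y" "y < l" "x' \<le> y'" "y' < l"
  shows "g' \<cong> g \<and> (x \<le> x' \<and> y' \<le> y \<or> x' \<le> x \<and> y \<le> y') \<or>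
         g' \<cong> g + int h \<and> y \<le> x' \<or> g \<cong> g' + int h \<and> y' \<le> x"
proof -
  \<comment> \<open>With the second edge starting \<open>t\<close> groups later, the ends alternate
    around the hull. Only for \<open>t = 0\<close> and \<open>t = int h\<close> do two ends fall
    into a common group, and there the order inside the group has to be assumed.\<close>
  have crossing: False
    if "long g x y \<in> T" "long g' x' y' \<in> T" "g' \<cong> g + t" "0 \<le> t" "t \<le> int h"
      "t = 0 \<Longrightarrow> x < x' \<and> y < y'" "t = int h \<Longrightarrow> x' < y"
      and xy: "x \<le> y" "y < l" "x' \<le> y'" "y' < l" for g g' t x y x' y'
  proof -
    have e: "{pt g x, pt (g + int h) y} \<in> T" "{pt (g + t) x', pt (g + t + int h) y'} \<in> T"
      using that long_cong[of g' "g + t" x' y'] by (auto simp: long_def)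
    show False
    proof (rule chords[OF T(1) e])
      show "R (pt g x) (pt (g + t) x')"
        using that R_groups[of t x x' g] R_within[of x x' g] by (cases "t = 0") auto
      show "R (pt (g + t) x') (pt (g + int h) y)"
        using that R_groups[of "int h - t" x' y "g + t"] R_within[of x' y "g + t"]
        by (cases "t = int h") auto
      show "R (pt (g + int h) y) (pt (g + t + int h) y')"
        using that R_groups[of t y y' "g + int h"] R_within[of y y' "g + int h"]
        by (cases "t = 0") (auto simp: algebra_simps)
    qed (use xy h_pos R_groups[of "int h" x y g] R_groups[of "int h" x' y' "g + t"] in auto)
  qed
  obtain t where t: "0 \<le> t" "t < int k" "g' \<cong> g + t" by (rule obtain_offset)
  \<comment> \<open>Here \<open>k - t\<close> replaces \<open>t\<close> once \<open>t\<close>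
    exceeds \<open>h\<close>: the roles of the two edges are swapped, and
    \<open>t = int h + 1\<close> becomes an offset of exactly \<open>h\<close> because
    \<open>k - (h + 1) = h\<close>.\<close>
  consider "t = 0" | "0 < t" "t < int h" | "t = int h" | "t = int h + 1" | "int h + 1 < t"
    using t by linarith
  then show ?thesis
  proof cases
    case 1
    then show ?thesis
      using crossing[of g x y g' x' y' 0] crossing[of g' x' y' g x y 0] T xy t same_group_sym[of g' g]
      by force
  next
    case 2
    then show ?thesis using crossing[of g x y g' x' y' t] T xy t by simp
  next
    case 3
    then show ?thesis
      using crossing[of g x y g' x' y' "int h"] T xy t h_pos by force
  next
    case 4
    have "int k dvd (g' - (g + t)) + int k" using t by simp
    then have "g' + int h \<cong> g" using 4 k_eq by (simp add: algebra_simps)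
    then have "g \<cong> g' + int h" by (rule same_group_sym)
    then show ?thesis
      using crossing[of g' x' y' g x y "int h"] T xy h_pos by force
  next
    case 5
    have "int k dvd (g' - (g + t)) + int k" using t by simp
    then have "g' + (int k - t) \<cong> g" by (simp add: algebra_simps)
    then have "g \<cong> g' + (int k - t)" by (rule same_group_sym)
    then show ?thesis
      using crossing[of g' x' y' g x y "int k - t"] T xy h_pos t 5 k_eq by force
  qed
qed

lemma less_k: "t < k \<longleftrightarrow> t \<le> 2 * h"
  using k_eq by auto

lemma half_turn_neq:
  shows "\<not> g \<cong> g + int h" "\<not> g + int h \<cong> g" "\<not> g \<cong> g + 2 * int h" "\<not> g + 2 * int h \<cong> g"
  using h_pos k_eq by (intro not_same_group; simp)+

text \<open>A long edge from group \<open>g\<close> is recorded as the interval from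
  \<open>x\<close> to \<open>y\<close>. Compatibility within one group becomes nesting of
  intervals.\<close>

definition fam :: "'a set set \<Rightarrow> int \<Rightarrow> (nat \<times> nat) set" where
  "fam T g = {(x, y). x \<le> y \<and> y < l \<and> long g x y \<in> T}"

lemma fam_cong: "g \<cong> g' \<Longrightarrow> fam T g = fam T g'"
  using long_cong[of g g'] by (auto simp: fam_def)

lemma fam_compat:
  assumes "T \<in> \<T>" "(x, y) \<in> fam T g" "(x', y') \<in> fam T g'"
  shows "g' \<cong> g \<and> (x \<le> x' \<and> y' \<le> y \<or> x' \<le> x \<and> y \<le> y') \<or>
         g' \<cong> g + int h \<and> y \<le> x' \<or> g \<cong> g' + int h \<and> y' \<le> x"
  using long_compat[of T g x y g' x' y'] assms by (auto simp: fam_def)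

lemma fam_nested:
  assumes "T \<in> \<T>" "(x, y) \<in> fam T g" "(x', y') \<in> fam T g"
  shows "x \<le> x' \<and> y' \<le> y \<or> x' \<le> x \<and> y \<le> y'"
  using fam_compat[OF assms] half_turn_neq by blast

lemma fam_consecutive:
  assumes "T \<in> \<T>" "(x, y) \<in> fam T g" "(x', y') \<in> fam T (g + int h)"
  shows "y \<le> x'"
  using fam_compat[OF assms] half_turn_neq[of g] by (auto simp: algebra_simps)

lemma finite_fam: "finite (fam T g)"
  by (rule finite_subset[of _ "{..<l} \<times> {..<l}"]) (auto simp: fam_def)

text \<open>Nested intervals of equal length coincide, so the lengths \<open>y - x\<close> are
  distinct natural numbers. The largest of them is therefore at least the number of intervals minus
  one.\<close>

lemma fam_max:
  assumes T: "T \<in> \<T>" and ne: "fam T g \<noteq> {}"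
  obtains x y where "(x, y) \<in> fam T g" "card (fam T g) \<le> y - x + 1"
proof -
  let ?d = "\<lambda>(x, y). y - x"
  have inj: "inj_on ?d (fam T g)"
  proof (rule inj_onI, clarify)
    fix x y x' y' assume a: "(x, y) \<in> fam T g" "(x', y') \<in> fam T g" "y - x = y' - x'"
    then show "x = x' \<and> y = y'" using fam_nested[OF T a(1,2)] by (auto simp: fam_def)
  qed
  have "Max (?d ` fam T g) \<in> ?d ` fam T g" using ne finite_fam by simp
  then obtain x y where xy: "(x, y) \<in> fam T g" "Max (?d ` fam T g) = y - x" by auto
  have "?d ` fam T g \<subseteq> {..y - x}"
    using Max_ge[of "?d ` fam T g"] finite_fam xy(2) by (metis atMost_iff finite_imageI subsetI)
  then have "card (?d ` fam T g) \<le> y - x + 1"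
    using card_mono[of "{..y - x}"] by simp
  then show ?thesis using that xy card_image[OF inj] by simp
qed

lemma third_family:
  assumes T: "T \<in> \<T>" and ne: "fam T g \<noteq> {}" "fam T (g + int h) \<noteq> {}" "fam T g' \<noteq> {}"
  shows "g' \<cong> g \<or> g' \<cong> g + int h"
proof (rule ccontr)
  assume n: "\<not> ?thesis"
  obtain x y x' y' x'' y'' where
    f: "(x, y) \<in> fam T g" "(x', y') \<in> fam T (g + int h)" "(x'', y'') \<in> fam T g'"
    using ne by fastforce
  have 1: "g \<cong> g' + int h" "y'' \<le> x" using fam_compat[OF T f(1,3)] n by auto
  have "\<not> g + int h \<cong> g' + int h" using same_group_sym[of g g'] n by auto
  then have 2: "g' \<cong> g + int h + int h" "y' \<le> x''" using fam_compat[OF T f(2,3)] n by auto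
  have "int k dvd (g - (g' + int h)) + (g' - (g + int h + int h))" using 1(1) 2(1) by (rule dvd_add)
  then have "int k dvd 3 * int h" by (simp add: algebra_simps)
  \<comment> \<open>Three families would follow one another cyclically in steps of \<open>h\<close>,
    so \<open>k\<close> divides \<open>3 * h\<close>. As \<open>3 * h - k = h - 1\<close> lies
    between \<open>0\<close> and \<open>k\<close>, only \<open>h = 1\<close> is possible.\<close>
  then have "int k dvd 3 * int h - int k" by (rule dvd_diff) simp
  then have "int k dvd int h - 1" using k_eq by (simp add: algebra_simps)
  then have h1: "h = 1" using not_dvd_small[of "int h - 1"] h_pos k_eq by fastforce
  have "y \<le> x'" by (rule fam_consecutive[OF T f(1,2)])
  \<comment> \<open>The inequalities run once around the cycle, so all six positions agree and the
    three edges form a triangle.\<close>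
  with 1 2 f have eq: "y = x" "x' = x" "y' = x" "x'' = x" "y'' = x" "x < l"
    by (auto simp: fam_def)
  have "pt g' x = pt (g + 2) x" "pt (g' + 1) x = pt g x"
    using 1 2 eq h1 same_group_sym[of g "g' + 1"] by (auto simp: pt_eq algebra_simps)
  moreover have "{pt g x, pt (g + int h) x} \<in> T"
    "{pt (g + int h) x, pt (g + int h + int h) x} \<in> T" "{pt g' x, pt (g' + int h) x} \<in> T"
    using f eq by (auto simp: fam_def long_def)
  ultimately have e: "{pt g x, pt (g + 1) x} \<in> T" "{pt (g + 1) x, pt (g + 2) x} \<in> T"
    "{pt (g + 2) x, pt g x} \<in> T"
    using h1 by (simp_all add: algebra_simps)
  have "distinct [pt g x, pt (g + 1) x, pt (g + 2) x]"
    using not_same_group[of g "g + 1"] not_same_group[of g "g + 2"]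
      not_same_group[of "g + 1" "g + 2"] h1 k_eq eq by (simp add: pt_eq)
  then show False using graph_cycle_triangle[OF _ e] acyclic[OF T] by blast
qed

text \<open>A long edge separates the centre from the hull points strictly between its ends. Within
  the groups from \<open>g\<close> to \<open>g + int h\<close> this leaves only positions up to
  \<open>x\<close> in the first and from \<open>y\<close> on in the last.\<close>

lemma spoke_outside_long:
  assumes T: "T \<in> \<T>" and f: "(x, y) \<in> fam T g"
    and s: "{v, pt (g + int s) z} \<in> T" "s \<le> h" "z < l"
  shows "s = 0 \<and> z \<le> x \<or> s = h \<and> y \<le> z"
proof (rule ccontr)
  assume n: "\<not> ?thesis"
  have e: "{pt g x, pt (g + int h) y} \<in> T" and xy: "x \<le> y" "y < l"
    using f by (auto simp: fam_def long_def)
  show False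
  proof (rule spoke[OF T e s(1)])
    show "R (pt g x) (pt (g + int s) z)"
      using n s xy R_groups[of "int s" x z g] R_within[of x z g] by (cases "s = 0") auto
    show "R (pt (g + int s) z) (pt (g + int h) y)"
      using n s xy R_groups[of "int h - int s" z y "g + int s"] R_within[of z y "g + int s"]
      by (cases "s = h") auto
    show "R (pt g x) (pt (g + int h) y)" using xy h_pos R_groups[of "int h" x y g] by auto
  qed
qed

lemma spokes_not_both_ends:
  assumes T: "T \<in> \<T>" "{a, b} \<in> T" "{v, a} \<in> T" "{v, b} \<in> T" "distinct [v, a, b]"
  shows False
  using graph_cycle_triangle[of v a b T] acyclic T by (simp add: insert_commute)

lemma spokes_not_both_ends_path:
  assumes T: "T \<in> \<T>" "{a, b} \<in> T" "{b, d} \<in> T" "{v, a} \<in> T" "{v, d} \<in> T" "distinct [v, a, b, d]"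
  shows False
  using graph_cycle_square[of v a b d T] acyclic T by (simp add: insert_commute)

text \<open>Spokes cannot cross a long edge, and the spokes together with one, respectively two, outermost
  long edges contain no cycle. This bounds the number of spokes; long edges are counted by
  nestedness.\<close>

lemma one_family:
  assumes T: "T \<in> \<T>" and ne: "fam T g \<noteq> {}" and only: "\<And>g'. fam T g' \<noteq> {} \<Longrightarrow> g' \<cong> g"
  shows "card (T \<inter> Longs) + card (T \<inter> Spokes) \<le> h * l + l + 1" (is ?le)
    and "card (T \<inter> Longs) + card (T \<inter> Spokes) = h * l + l + 1 \<Longrightarrow> h < t \<Longrightarrow> t < k \<Longrightarrow> z < l \<Longrightarrow>
           {v, pt (g + int t) z} \<in> T" (is "?eq \<Longrightarrow> _ \<Longrightarrow> _ \<Longrightarrow> _ \<Longrightarrow> ?rad")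
proof -
  obtain x y where f: "(x, y) \<in> fam T g" and cf: "card (fam T g) \<le> y - x + 1"
    by (rule fam_max[OF T ne])
  have xy: "x \<le> y" "y < l" "long g x y \<in> T" using f by (auto simp: fam_def)
  have "T \<inter> Longs \<subseteq> (\<lambda>(x, y). long g x y) ` fam T g"
  proof
    fix e assume e: "e \<in> T \<inter> Longs"
    then obtain g' x' y' where e': "e = long g' x' y'" "(x', y') \<in> fam T g'"
      by (auto simp: Longs_def fam_def)
    then have "g' \<cong> g" using only by blast
    then show "e \<in> (\<lambda>(x, y). long g x y) ` fam T g"
      using e' long_cong[of g' g x' y'] fam_cong[of g' g T] by (force simp: fam_def)
  qed
  with finite_fam have "card (T \<inter> Longs) \<le> card (fam T g)" by (rule surj_card_le)
  with cf have N: "card (T \<inter> Longs) \<le> y - x + 1" by simp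
  \<comment> \<open>\<open>W\<close> holds the spoke positions not blocked by the outermost long
    edge; the \<open>h\<close> groups beyond \<open>g + int h\<close> are entirely free.\<close>
  define W where "W = {0} \<times> {..x} \<union> {h} \<times> {y..<l} \<union> {h<..<k} \<times> {..<l}"
  have finW: "finite W" by (simp add: W_def)
  have "card W = card ({0::nat} \<times> {..x}) + card ({h} \<times> {y..<l}) + card ({h<..<k} \<times> {..<l})"
    unfolding W_def using h_pos by (subst card_Un_disjoint; (subst card_Un_disjoint)?) auto
  then have cW: "card W = x + 1 + (l - y) + h * l"
    using k_eq by (simp add: card_cartesian_product)
  have sub: "rad T g \<subseteq> W"
    using spoke_outside_long[OF T f] by (force simp: rad_def W_def)
  have lT: "{pt g x, pt (g + int h) y} \<in> T" using xy by (simp add: long_def)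
  have ends: "pt g x \<noteq> v" "pt (g + int h) y \<noteq> v" "pt g x \<noteq> pt (g + int h) y"
    using pt_neq_v half_turn_neq(1)[of g] xy by (auto simp: pt_eq)
  \<comment> \<open>Spokes to both ends of the long edge would close a triangle, so one end position
    is missing. It lies in group \<open>0\<close> or \<open>h\<close>; hence in the case of equality
    nothing is missing beyond group \<open>h\<close>.\<close>
  have "\<exists>p. p \<in> W \<and> p \<notin> rad T g \<and> fst p \<le> h"
  proof (cases "{v, pt g x} \<in> T")
    case True
    then have "{v, pt (g + int h) y} \<notin> T"
      using spokes_not_both_ends[OF T lT True] ends by auto
    then have "(h, y) \<in> W \<and> (h, y) \<notin> rad T g" using xy by (auto simp: W_def rad_def)
    then show ?thesis by force
  next
    case False
    then have "(0, x) \<in> W \<and> (0, x) \<notin> rad T g" using xy by (auto simp: W_def rad_def)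
    then show ?thesis by force
  qed
  then obtain p where p: "p \<in> W" "p \<notin> rad T g" "fst p \<le> h" by blast
  then have cr: "card (rad T g) < card W" using sub finW by (metis psubsetI psubset_card_mono)
  show ?le using N cr cW xy unfolding card_rad[of T g, symmetric] by linarith
  assume ?eq and t: "h < t" "t < k" and z: "z < l"
  then have *: "card (rad T g) + 1 = card W"
    using N cr cW xy unfolding card_rad[of T g, symmetric] by linarith
  show ?rad
  proof (rule ccontr)
    assume "\<not> ?rad"
    then have q: "(t, z) \<notin> rad T g" "(t, z) \<in> W" "(t, z) \<noteq> p"
      using t z p by (auto simp: rad_def W_def)
    have "card (rad T g \<union> {p, (t, z)}) \<le> card W"
      using sub q p finW by (intro card_mono) auto
    then show False using * p q finite_rad by simp
  qed
qed

lemma two_families: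
  assumes T: "T \<in> \<T>" and ne: "fam T g \<noteq> {}" "fam T (g + int h) \<noteq> {}"
  shows "card (T \<inter> Longs) + card (T \<inter> Spokes) \<le> l + 2" (is ?le)
    and "card (T \<inter> Longs) + card (T \<inter> Spokes) = l + 2 \<Longrightarrow>
          (\<And>z. z < l \<Longrightarrow> {v, pt (g + int h) z} \<notin> T) \<Longrightarrow>
           {v, pt g 0} \<in> T \<or> {v, pt (g + 2 * int h) (l - 1)} \<in> T"
          (is "?eq \<Longrightarrow> (\<And>z. _ z \<Longrightarrow> _ z) \<Longrightarrow> ?rad")
proof -
  obtain x1 y1 where f1: "(x1, y1) \<in> fam T g" and cf1: "card (fam T g) \<le> y1 - x1 + 1"
    by (rule fam_max[OF T ne(1)])
  obtain x2 y2 where f2: "(x2, y2) \<in> fam T (g + int h)"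
    and cf2: "card (fam T (g + int h)) \<le> y2 - x2 + 1"
    by (rule fam_max[OF T ne(2)])
  have xy: "x1 \<le> y1" "y1 \<le> x2" "x2 \<le> y2" "y2 < l"
    and lT: "{pt g x1, pt (g + int h) y1} \<in> T" "{pt (g + int h) x2, pt (g + 2 * int h) y2} \<in> T"
    using f1 f2 fam_consecutive[OF T f1 f2] by (auto simp: fam_def long_def algebra_simps)
  have "T \<inter> Longs \<subseteq> (\<lambda>(x, y). long g x y) ` fam T g \<union>
          (\<lambda>(x, y). long (g + int h) x y) ` fam T (g + int h)" (is "_ \<subseteq> ?A \<union> ?B")
  proof
    fix e assume e: "e \<in> T \<inter> Longs"
    then obtain g' x' y' where e': "e = long g' x' y'" "(x', y') \<in> fam T g'"
      by (auto simp: Longs_def fam_def)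
    then have "g' \<cong> g \<or> g' \<cong> g + int h" using third_family[OF T ne] by blast
    then show "e \<in> ?A \<union> ?B"
    proof
      assume "g' \<cong> g"
      then have "e \<in> ?A"
        using e' long_cong[of g' g x' y'] fam_cong[of g' g T] by (force simp: fam_def)
      then show ?thesis by blast
    next
      assume "g' \<cong> g + int h"
      then have "e \<in> ?B"
        using e' long_cong[of g' "g + int h" x' y'] fam_cong[of g' "g + int h" T]
        by (force simp: fam_def)
      then show ?thesis by blast
    qed
  qed
  then have "card (T \<inter> Longs) \<le> card (?A \<union> ?B)" using finite_fam by (intro card_mono) auto
  also have "\<dots> \<le> card ?A + card ?B" by (rule card_Un_le)
  also have "\<dots> \<le> card (fam T g) + card (fam T (g + int h))"
    by (intro add_mono card_image_le finite_fam)
  finally have N: "card (T \<inter> Longs) \<le> (y1 - x1 + 1) + (y2 - x2 + 1)" using cf1 cf2 by linarith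
  \<comment> \<open>Each outermost edge blocks its own half of the groups. Since
    \<open>2 * h\<close> is the last offset, what remains are the outer parts of the two extreme
    groups and, in the apex group, the positions from \<open>y1\<close> to
    \<open>x2\<close>.\<close>
  define W where "W = {0} \<times> {..x1} \<union> {h} \<times> {y1..x2} \<union> {2 * h} \<times> {y2..<l}"
  have finW: "finite W" by (simp add: W_def)
  have "card W = card ({0::nat} \<times> {..x1}) + card ({h} \<times> {y1..x2}) + card ({2 * h} \<times> {y2..<l})"
    unfolding W_def using h_pos by (subst card_Un_disjoint; (subst card_Un_disjoint)?) auto
  then have cW: "card W = (x1 + 1) + (x2 + 1 - y1) + (l - y2)"
    using k_eq by (simp add: card_cartesian_product)
  have sub: "rad T g \<subseteq> W"
  proof clarify
    fix t z assume "(t, z) \<in> rad T g"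
    then have tz: "t \<le> 2 * h" "z < l" "{v, pt (g + int t) z} \<in> T"
      by (auto simp: rad_def less_k)
    have 1: "t = 0 \<and> z \<le> x1 \<or> t = h \<and> y1 \<le> z" if "t \<le> h"
      using spoke_outside_long[OF T f1 tz(3)] tz that by auto
    have 2: "t = h \<and> z \<le> x2 \<or> t = 2 * h \<and> y2 \<le> z" if "h \<le> t"
    proof -
      have "t - h \<le> h" "g + int h + int (t - h) = g + int t" using that tz by auto
      then have "t - h = 0 \<and> z \<le> x2 \<or> t - h = h \<and> y2 \<le> z"
        using spoke_outside_long[OF T f2, of "t - h" z] tz by simp
      then show ?thesis using that by linarith
    qed
    show "(t, z) \<in> W" using 1 2 tz h_pos unfolding W_def by (cases "t \<le> h") auto
  qed
  have W4: "(0, x1) \<in> W" "(h, y1) \<in> W" "(h, x2) \<in> W" "(2 * h, y2) \<in> W"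
    using xy by (auto simp: W_def)
  have rad4: "(0, x1) \<in> rad T g \<longleftrightarrow> {v, pt g x1} \<in> T"
    "(h, y1) \<in> rad T g \<longleftrightarrow> {v, pt (g + int h) y1} \<in> T"
    "(h, x2) \<in> rad T g \<longleftrightarrow> {v, pt (g + int h) x2} \<in> T"
    "(2 * h, y2) \<in> rad T g \<longleftrightarrow> {v, pt (g + 2 * int h) y2} \<in> T"
    using xy by (auto simp: rad_def less_k)
  have ne: "pt g x1 \<noteq> pt (g + int h) y1" "pt (g + int h) x2 \<noteq> pt (g + 2 * int h) y2"
    "pt g x1 \<noteq> pt (g + 2 * int h) y2"
    using xy half_turn_neq[of g] half_turn_neq[of "g + int h"] by (auto simp: pt_eq algebra_simps)
  have nv: "pt g x1 \<noteq> v" "pt (g + int h) y1 \<noteq> v" "pt (g + int h) x2 \<noteq> v"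
    "pt (g + 2 * int h) y2 \<noteq> v"
    using pt_neq_v xy by auto
  have n1: "(0, x1) \<notin> rad T g \<or> (h, y1) \<notin> rad T g"
    unfolding rad4 using spokes_not_both_ends[OF T lT(1)] ne nv by auto
  have n2: "(h, x2) \<notin> rad T g \<or> (2 * h, y2) \<notin> rad T g"
    unfolding rad4 using spokes_not_both_ends[OF T lT(2)] ne nv by auto
  have n3: "(0, x1) \<notin> rad T g \<or> (2 * h, y2) \<notin> rad T g" if "x2 = y1"
    unfolding rad4 using spokes_not_both_ends_path[OF T lT(1)] lT(2) ne nv that by auto
  \<comment> \<open>Each edge makes one of its ends miss a spoke. If the edges share their apex, one
    missing position could serve both; the 4-cycle through \<open>v\<close> and the apex, excluded
    by \<open>n3\<close>, then supplies a second one.\<close>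
  have "\<exists>p q. p \<in> W \<and> q \<in> W \<and> p \<noteq> q \<and> p \<notin> rad T g \<and> q \<notin> rad T g"
  proof (cases "x2 = y1")
    case True
    with n1 n2 n3 consider "(0, x1) \<notin> rad T g" "(h, y1) \<notin> rad T g"
      | "(h, y1) \<notin> rad T g" "(2 * h, y2) \<notin> rad T g"
      | "(0, x1) \<notin> rad T g" "(2 * h, y2) \<notin> rad T g" by blast
    moreover have "(0, x1) \<noteq> (h, y1)" "(h, y1) \<noteq> (2 * h, y2)" "(0, x1) \<noteq> (2 * h, y2)"
      using h_pos by auto
    ultimately show ?thesis using W4 by cases blast+
  next
    case False
    obtain p where p: "p \<in> {(0, x1), (h, y1)}" "p \<notin> rad T g" using n1 by blast
    obtain q where q: "q \<in> {(h, x2), (2 * h, y2)}" "q \<notin> rad T g" using n2 by blast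
    have "p \<noteq> q" "p \<in> W" "q \<in> W" using p q False h_pos W4 by auto
    then show ?thesis using p q by blast
  qed
  then obtain p q where pq: "p \<in> W" "q \<in> W" "p \<noteq> q" "p \<notin> rad T g" "q \<notin> rad T g" by blast
  have "card (rad T g \<union> {p, q}) \<le> card W" using sub pq finW by (intro card_mono) auto
  then have cr: "card (rad T g) + 2 \<le> card W" using pq finite_rad by simp
  show ?le using N cr cW xy unfolding card_rad[of T g, symmetric] by linarith
  assume ?eq and no: "\<And>z. z < l \<Longrightarrow> {v, pt (g + int h) z} \<notin> T"
  then have *: "card (rad T g) + 2 = card W"
    using N cr cW xy unfolding card_rad[of T g, symmetric] by linarith
  show ?rad
  proof (rule ccontr)
    assume "\<not> ?rad"
    \<comment> \<open>Equality allows exactly two missing positions in \<open>W\<close>. The apex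
      position \<open>(h, y1)\<close> is already one, so the two positions bordering the opposite
      gap cannot both be missing.\<close>
    then have u: "(0, 0) \<notin> rad T g" "(h, y1) \<notin> rad T g" "(2 * h, l - 1) \<notin> rad T g"
      using no[of y1] xy by (auto simp: rad_def)
    have "(0, 0) \<in> W" "(2 * h, l - 1) \<in> W" using xy by (auto simp: W_def)
    then have "card (rad T g \<union> {(0, 0), (h, y1), (2 * h, l - 1)}) \<le> card W"
      using sub W4 finW by (intro card_mono) auto
    then show False using * u finite_rad h_pos by simp
  qed
qed

section \<open>Distribution of the diagonals over the trees\<close>

abbreviation edges :: "'a set set" where
  "edges \<equiv> complete_edges (insert v {pt g x |g x. x < l})"

lemma finite_edges: "finite edges"
proof -
  have "{pt g x |g x. x < l} = (\<lambda>(g, x). pt g x) ` ({0..<int k} \<times> {..<l})"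
  proof
    show "{pt g x |g x. x < l} \<subseteq> (\<lambda>(g, x). pt g x) ` ({0..<int k} \<times> {..<l})"
    proof
      fix p assume "p \<in> {pt g x |g x. x < l}"
      then obtain g x where p: "p = pt g x" "x < l" by blast
      obtain g' where "g' \<in> {0..<int k}" "g \<cong> g'" by (rule residue)
      then have "p = (\<lambda>(g, x). pt g x) (g', x)" "(g', x) \<in> {0..<int k} \<times> {..<l}"
        using p by (auto simp: pt_eq)
      then show "p \<in> (\<lambda>(g, x). pt g x) ` ({0..<int k} \<times> {..<l})" by (rule image_eqI)
    qed
  qed auto
  then have "finite {pt g x |g x. x < l}" by simp
  then show ?thesis by (simp add: complete_edges_def)
qed

lemma long_in_edges: "x < l \<Longrightarrow> y < l \<Longrightarrow> long g x y \<in> edges"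
  using half_turn_neq(1)[of g] pt_eq[of x y g "g + int h"]
  by (auto simp: complete_edges_def long_def)

lemma Longs_subset: "Longs \<subseteq> edges"
  using long_in_edges by (auto simp: Longs_def)

lemma Diags_subset: "Diags \<subseteq> edges"
  using long_in_edges by (auto simp: Diags_def)

lemma Spokes_subset: "Spokes \<subseteq> edges"
  using pt_neq_v[symmetric] by (auto simp: complete_edges_def Spokes_def)

lemma finite_\<T>: "finite \<T>"
  using part finite_edges by (rule finite_elements[rotated])

lemma sum_card_Int: "S \<subseteq> edges \<Longrightarrow> (\<Sum>T\<in>\<T>. card (T \<inter> S)) = card S"
  using part finite_edges by (rule sum_card_Int_partition_on)

lemma tree_unique: "\<lbrakk>T \<in> \<T>; U \<in> \<T>; e \<in> T; e \<in> U\<rbrakk> \<Longrightarrow> T = U"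
  using part unfolding partition_on_def disjoint_def by blast

definition diags_at :: "int \<Rightarrow> 'a set set" where "diags_at g = {long g x x |x. x < l}"
text \<open>Diagonals are attributed to their starting group only. The trees with diagonals on both
  sides of the apex group \<open>g + int h\<close> are then
  \<open>trees_at g \<inter> trees_at (g + int h)\<close>.\<close>

definition trees_at :: "int \<Rightarrow> 'a set set set" where "trees_at g = {T \<in> \<T>. T \<inter> diags_at g \<noteq> {}}"

lemma diags_at_cong: "g \<cong> g' \<Longrightarrow> diags_at g = diags_at g'"
  using long_cong[of g g'] by (auto simp: diags_at_def)

lemma trees_at_cong: "g \<cong> g' \<Longrightarrow> trees_at g = trees_at g'"
  using diags_at_cong[of g g'] by (simp add: trees_at_def)

lemma fam_nonempty_if_diag: "T \<inter> diags_at g \<noteq> {} \<Longrightarrow> fam T g \<noteq> {}"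
  by (auto simp: fam_def diags_at_def)

lemma trees_atD: "T \<in> trees_at g \<Longrightarrow> T \<in> \<T>" "T \<in> trees_at g \<Longrightarrow> fam T g \<noteq> {}"
  using fam_nonempty_if_diag by (auto simp: trees_at_def)

lemma finite_diags_at: "finite (diags_at g)"
  by (simp add: diags_at_def)

lemma diags_at_subset: "diags_at g \<subseteq> Diags"
  by (auto simp: diags_at_def Diags_def)

lemma card_diags_at: "card (diags_at g) = l"
proof -
  have "diags_at g = (\<lambda>x. long g x x) ` {..<l}" by (auto simp: diags_at_def)
  moreover have "inj_on (\<lambda>x. long g x x) {..<l}" by (auto simp: inj_on_def long_eq_iff)
  ultimately show ?thesis by (simp add: card_image)
qed

text \<open>Diagonals are intervals of length zero, and two such intervals are nested only if they
  are equal.\<close>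

lemma card_Int_diags_at_le:
  assumes "T \<in> \<T>" shows "card (T \<inter> diags_at g) \<le> 1"
proof -
  have "long g x x = long g x' x'"
    if "x < l" "x' < l" "long g x x \<in> T" "long g x' x' \<in> T" for x x'
    using fam_nested[OF assms, of x x g x' x'] that by (auto simp: fam_def)
  then have "\<forall>e\<in>T \<inter> diags_at g. \<forall>e'\<in>T \<inter> diags_at g. e = e'"
    unfolding diags_at_def by blast
  then show ?thesis using finite_diags_at by (metis card_le_Suc0_iff_eq finite_Int One_nat_def)
qed

lemma diags_disjoint: "\<not> g \<cong> g' \<Longrightarrow> diags_at g \<inter> diags_at g' = {}"
  by (auto simp: diags_at_def long_eq_iff)

lemma Diags_Int_cases:
  assumes "e \<in> T \<inter> Diags"
  obtains g where "fam T g \<noteq> {}" "e \<in> T \<inter> diags_at g"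
proof -
  obtain g x where "e = long g x x" "x < l" using assms by (auto simp: Diags_def)
  then have "e \<in> T \<inter> diags_at g" using assms by (auto simp: diags_at_def)
  then show ?thesis using that fam_nonempty_if_diag by blast
qed

text \<open>By \<open>fam_compat\<close>, two families from different groups start \<open>h\<close>
  groups apart, in one order or the other.\<close>

lemma family_cases:
  assumes T: "T \<in> \<T>"
  obtains (none) "\<And>g. fam T g = {}"
    | (one) g where "fam T g \<noteq> {}" "\<And>g'. fam T g' \<noteq> {} \<Longrightarrow> g' \<cong> g"
    | (two) g where "fam T g \<noteq> {}" "fam T (g + int h) \<noteq> {}"
proof -
  consider "\<forall>g. fam T g = {}" | g where "fam T g \<noteq> {}" "\<forall>g'. fam T g' \<noteq> {} \<longrightarrow> g' \<cong> g"
    | g g' where "fam T g \<noteq> {}" "fam T g' \<noteq> {}" "\<not> g' \<cong> g" by blast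
  then show ?thesis
  proof cases
    case 3
    then obtain x y x' y' where f: "(x, y) \<in> fam T g" "(x', y') \<in> fam T g'" by fastforce
    consider "g' \<cong> g + int h" | "g \<cong> g' + int h" using fam_compat[OF T f] 3 by blast
    then show ?thesis
      using two[of g] two[of g'] 3 fam_cong[of g' "g + int h" T] fam_cong[of g "g' + int h" T]
      by cases auto
  qed (use one none in auto)
qed

lemma diags_two_families:
  assumes T: "T \<in> \<T>" and ne: "fam T g \<noteq> {}" "fam T (g + int h) \<noteq> {}"
  shows "T \<inter> Diags = (T \<inter> diags_at g) \<union> (T \<inter> diags_at (g + int h))"
proof
  show "T \<inter> Diags \<subseteq> (T \<inter> diags_at g) \<union> (T \<inter> diags_at (g + int h))"
  proof
    fix e assume "e \<in> T \<inter> Diags"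
    then obtain g' where g': "fam T g' \<noteq> {}" "e \<in> T \<inter> diags_at g'" by (rule Diags_Int_cases)
    then have "g' \<cong> g \<or> g' \<cong> g + int h" using third_family[OF T ne] by blast
    then show "e \<in> (T \<inter> diags_at g) \<union> (T \<inter> diags_at (g + int h))"
      using g' diags_at_cong by auto
  qed
qed (use diags_at_subset in auto)

lemma diags_one_family:
  assumes "fam T g \<noteq> {}" "\<And>g'. fam T g' \<noteq> {} \<Longrightarrow> g' \<cong> g"
  shows "T \<inter> Diags = T \<inter> diags_at g"
proof
  show "T \<inter> Diags \<subseteq> T \<inter> diags_at g"
  proof
    fix e assume "e \<in> T \<inter> Diags"
    then obtain g' where g': "fam T g' \<noteq> {}" "e \<in> T \<inter> diags_at g'" by (rule Diags_Int_cases)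
    then show "e \<in> T \<inter> diags_at g" using assms(2)[of g'] diags_at_cong[of g' g] by auto
  qed
qed (use diags_at_subset in auto)

lemma diags_no_family: "(\<And>g. fam T g = {}) \<Longrightarrow> T \<inter> Diags = {}"
  by (metis Diags_Int_cases equals0I)

lemma card_Diags_Int_le:
  assumes T: "T \<in> \<T>" shows "card (T \<inter> Diags) \<le> 2"
  using T
proof (cases rule: family_cases)
  case none
  then show ?thesis by (simp add: diags_no_family)
next
  case (one g)
  then show ?thesis using diags_one_family[of T g] card_Int_diags_at_le[OF T, of g] by simp
next
  case (two g)
  then show ?thesis
    using diags_two_families[OF T two] card_Un_le[of "T \<inter> diags_at g" "T \<inter> diags_at (g + int h)"]
      card_Int_diags_at_le[OF T, of g] card_Int_diags_at_le[OF T, of "g + int h"] by simp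
qed

lemma two_diags:
  assumes T: "T \<in> \<T>" and c: "card (T \<inter> Diags) = 2"
  obtains g where "T \<in> trees_at g" "T \<in> trees_at (g + int h)"
    "T \<inter> Diags = (T \<inter> diags_at g) \<union> (T \<inter> diags_at (g + int h))"
  using T
proof (cases rule: family_cases)
  case none
  then show ?thesis using c by (simp add: diags_no_family)
next
  case (one g)
  then show ?thesis using diags_one_family[of T g] card_Int_diags_at_le[OF T, of g] c by simp
next
  case (two g)
  note eq = diags_two_families[OF T two]
  have "T \<inter> diags_at g \<noteq> {}"
  proof
    assume "T \<inter> diags_at g = {}"
    then show False using eq c card_Int_diags_at_le[OF T, of "g + int h"] by simp
  qed
  moreover have "T \<inter> diags_at (g + int h) \<noteq> {}"
  proof
    assume "T \<inter> diags_at (g + int h) = {}"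
    then show False using eq c card_Int_diags_at_le[OF T, of g] by simp
  qed
  ultimately show ?thesis using that[of g] T eq by (simp add: trees_at_def)
qed

lemma weight_le_if_two_diags:
  assumes T: "T \<in> \<T>" and c: "card (T \<inter> Diags) = 2"
  shows "card (T \<inter> Longs) + card (T \<inter> Spokes) \<le> l + 2"
proof -
  obtain g where "T \<in> trees_at g" "T \<in> trees_at (g + int h)" by (rule two_diags[OF T c])
  then show ?thesis using two_families(1)[OF T] trees_atD(2) by blast
qed

lemma one_diag:
  assumes T: "T \<in> \<T>" and c: "card (T \<inter> Diags) = 1" and l: "2 \<le> l"
  shows "card (T \<inter> Longs) + card (T \<inter> Spokes) \<le> h * l + l + 1" (is ?le)
    and "card (T \<inter> Longs) + card (T \<inter> Spokes) = h * l + l + 1 \<Longrightarrow>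
           \<exists>g. T \<in> trees_at g \<and> (\<forall>g'. T \<in> trees_at g' \<longrightarrow> g' \<cong> g) \<and>
             (\<forall>t z. h < t \<longrightarrow> t < k \<longrightarrow> z < l \<longrightarrow> {v, pt (g + int t) z} \<in> T)" (is "?eq \<Longrightarrow> ?ex")
proof -
  have "?le \<and> (?eq \<longrightarrow> ?ex)" using T
  proof (cases rule: family_cases)
    case none
    then show ?thesis using c by (simp add: diags_no_family)
  next
    case (one g)
    have "T \<inter> diags_at g \<noteq> {}" using diags_one_family[OF one] c by force
    then have "T \<in> trees_at g" using T by (simp add: trees_at_def)
    moreover have "\<forall>g'. T \<in> trees_at g' \<longrightarrow> g' \<cong> g"
      using one(2) fam_nonempty_if_diag by (simp add: trees_at_def)
    ultimately show ?thesis using one_family[OF T one] by blast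
  next
    case (two g)
    \<comment> \<open>Two families give weight at most \<open>l + 2\<close>, which is strictly below
      \<open>h * l + l + 1\<close>; so this case satisfies the bound and cannot attain it.\<close>
    have "1 * 2 \<le> h * l" using h_pos l by (intro mult_le_mono)
    then show ?thesis using two_families(1)[OF T two] by linarith
  qed
  then show ?le "?eq \<Longrightarrow> ?ex" by blast+
qed

text \<open>Each of the \<open>l\<close> diagonals starting in \<open>g\<close> lies in one tree,
  and no tree contains two of them.\<close>

lemma card_trees_at: "card (trees_at g) = l"
proof -
  have "card (T \<inter> diags_at g) = (if T \<inter> diags_at g \<noteq> {} then 1 else 0)" if "T \<in> \<T>" for T
    using card_Int_diags_at_le[OF that, of g] finite_diags_at[of g] card_0_eq[of "T \<inter> diags_at g"]
    by (auto simp: le_Suc_eq)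
  then have "(\<Sum>T\<in>\<T>. card (T \<inter> diags_at g)) = (\<Sum>T\<in>\<T>. if T \<inter> diags_at g \<noteq> {} then 1 else 0)"
    by (intro sum.cong) auto
  also have "\<dots> = card (trees_at g)"
    using finite_\<T> by (simp add: sum.If_cases trees_at_def Int_def)
  finally show ?thesis
    using sum_card_Int[of "diags_at g"] diags_at_subset[of g] Diags_subset card_diags_at[of g] by auto
qed

section \<open>Tightness of the weights and the contradiction\<close>

lemma card_trees_containing: "card {T \<in> \<T>. e \<in> T} \<le> 1"
proof -
  have "\<forall>T\<in>{T \<in> \<T>. e \<in> T}. \<forall>U\<in>{T \<in> \<T>. e \<in> T}. T = U" using tree_unique by blast
  then show ?thesis using finite_\<T> by (simp add: card_le_Suc0_iff_eq)
qed

lemma tight_weights: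
  assumes l: "2 \<le> l"
  obtains T0 g0 where "T0 \<in> \<T>" "T0 \<in> trees_at g0" "\<forall>g. T0 \<in> trees_at g \<longrightarrow> g \<cong> g0"
    "\<forall>t z. h < t \<longrightarrow> t < k \<longrightarrow> z < l \<longrightarrow> {v, pt (g0 + int t) z} \<in> T0"
    "\<forall>T\<in>\<T> - {T0}. card (T \<inter> Diags) = 2 \<and> card (T \<inter> Longs) + card (T \<inter> Spokes) = l + 2"
proof -
  \<comment> \<open>The deficits from two diagonals add up to
    \<open>2 * card \<T> - k * l = 1\<close>, so exactly one tree falls short, and by one.\<close>
  have "(\<Sum>T\<in>\<T>. 2 - card (T \<inter> Diags)) + (\<Sum>T\<in>\<T>. card (T \<inter> Diags)) = (\<Sum>T\<in>\<T>. 2)"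
    unfolding sum.distrib[symmetric] using card_Diags_Int_le by (intro sum.cong) auto
  then have "(\<Sum>T\<in>\<T>. 2 - card (T \<inter> Diags)) = 1"
    using card_\<T> sum_card_Int[OF Diags_subset] card_Diags by simp
  then obtain T0 where T0: "T0 \<in> \<T>" "2 - card (T0 \<inter> Diags) = 1"
    and others: "\<forall>T\<in>\<T>. T0 \<noteq> T \<longrightarrow> 2 - card (T \<inter> Diags) = 0"
    unfolding sum_eq_1_iff[OF finite_\<T>] by blast
  have d0: "card (T0 \<inter> Diags) = 1" using T0 by simp
  have d2: "card (T \<inter> Diags) = 2" if "T \<in> \<T>" "T \<noteq> T0" for T
    using others card_Diags_Int_le[OF that(1)] that by force
  let ?w = "\<lambda>T. card (T \<inter> Longs) + card (T \<inter> Spokes)"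
  let ?b = "\<lambda>T. if T = T0 then h * l + l + 1 else l + 2"
  have le: "?w T \<le> ?b T" if "T \<in> \<T>" for T
    using that one_diag(1)[OF T0(1) d0 l] weight_le_if_two_diags[OF that] d2[OF that] by auto
  have "2 * (\<Sum>T\<in>\<T>. ?w T) = k * (l * (l + 1)) + 2 * (k * l)"
    using card_Longs card_Spokes sum_card_Int[OF Longs_subset] sum_card_Int[OF Spokes_subset]
    by (simp add: sum.distrib)
  \<comment> \<open>The individual bounds add up to exactly the number of long edges and spokes, so
    none of them can be strict.\<close>
  moreover have "2 * (\<Sum>T\<in>\<T>. ?b T) = k * (l * (l + 1)) + 2 * (k * l)"
  proof -
    have "(\<Sum>T\<in>\<T>. ?b T) = (h * l + l + 1) + (\<Sum>T\<in>\<T> - {T0}. ?b T)"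
      using T0 finite_\<T> by (subst sum.remove[of _ T0]) auto
    also have "(\<Sum>T\<in>\<T> - {T0}. ?b T) = (\<Sum>T\<in>\<T> - {T0}. l + 2)" by (intro sum.cong) auto
    also have "\<dots> = (card \<T> - 1) * (l + 2)" using T0 finite_\<T> by simp
    finally have "2 * (\<Sum>T\<in>\<T>. ?b T) = 2 * (h * l + l + 1) + (2 * card \<T> - 2) * (l + 2)"
      by (simp add: algebra_simps)
    also have "2 * card \<T> - 2 = k * l - 1" using card_\<T> by simp
    also have "2 * (h * l + l + 1) + (k * l - 1) * (l + 2) = k * (l * (l + 1)) + 2 * (k * l)"
    proof -
      \<comment> \<open>Passing to integers removes the truncated subtraction in
        \<open>k * l - 1\<close>.\<close>
      obtain m where "k * l = Suc m" using k_eq l_pos by (cases "k * l") auto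
      then have m: "int m = int k * int l - 1" by (metis of_nat_Suc of_nat_mult add_diff_cancel_left')
      have "int (2 * (h * l + l + 1) + (k * l - 1) * (l + 2)) =
          2 * (int h * int l + int l + 1) + int m * (int l + 2)"
        using \<open>k * l = Suc m\<close> by (simp add: algebra_simps)
      also have "\<dots> = int (k * (l * (l + 1)) + 2 * (k * l))"
        unfolding m using k_eq by (simp add: algebra_simps)
      finally show ?thesis by linarith
    qed
    finally show ?thesis .
  qed
  ultimately have "(\<Sum>T\<in>\<T>. ?w T) = (\<Sum>T\<in>\<T>. ?b T)" by linarith
  then have eq: "?w T = ?b T" if "T \<in> \<T>" for T
    using sum_mono_inv[of ?w \<T> ?b] le that finite_\<T> by blast
  have "?w T0 = h * l + l + 1" using eq[OF T0(1)] by simp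
  then obtain g0 where "T0 \<in> trees_at g0" "\<forall>g. T0 \<in> trees_at g \<longrightarrow> g \<cong> g0"
    "\<forall>t z. h < t \<longrightarrow> t < k \<longrightarrow> z < l \<longrightarrow> {v, pt (g0 + int t) z} \<in> T0"
    using one_diag(2)[OF T0(1) d0 l] by blast
  then show ?thesis using that[OF T0(1)] d2 eq by simp
qed

theorem no_wheel_forests:
  assumes l: "5 \<le> l"
  shows False
proof -
  have "2 \<le> l" using l by simp
  then obtain T0 g0 where T0: "T0 \<in> \<T>" "T0 \<in> trees_at g0" "\<forall>g. T0 \<in> trees_at g \<longrightarrow> g \<cong> g0"
    and spokes0: "\<forall>t z. h < t \<longrightarrow> t < k \<longrightarrow> z < l \<longrightarrow> {v, pt (g0 + int t) z} \<in> T0"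
    and others: "\<forall>T\<in>\<T> - {T0}. card (T \<inter> Diags) = 2 \<and>
      card (T \<inter> Longs) + card (T \<inter> Spokes) = l + 2"
    by (rule tight_weights)
  have finite_trees: "finite (trees_at g)" for g using finite_\<T> by (simp add: trees_at_def)
  \<comment> \<open>\<open>T0\<close> owns every spoke to the apex group, so the trees counted here
    have none there. Each must use one of two gap spokes, and each gap spoke lies in at most one
    tree.\<close>
  have apex: "card (trees_at g \<inter> trees_at (g + int h)) \<le> 2"
    if t: "h < t" "t < k" "g + int h \<cong> g0 + int t" and g: "\<not> g + int h \<cong> g0" for g t
  proof -
    have "trees_at g \<inter> trees_at (g + int h) \<subseteq>
        {T \<in> \<T>. {v, pt g 0} \<in> T} \<union> {T \<in> \<T>. {v, pt (g + 2 * int h) (l - 1)} \<in> T}"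
    proof
      fix T assume T: "T \<in> trees_at g \<inter> trees_at (g + int h)"
      then have T': "T \<in> \<T>" "fam T g \<noteq> {}" "fam T (g + int h) \<noteq> {}" "T \<noteq> T0"
        using T0(3) g trees_atD by blast+
      have "{v, pt (g + int h) z} \<notin> T" if "z < l" for z
      proof -
        have "pt (g + int h) z = pt (g0 + int t) z" using t that by (simp add: pt_eq)
        then show ?thesis using spokes0 t that tree_unique[OF T'(1) T0(1)] T'(4) by metis
      qed
      then have "{v, pt g 0} \<in> T \<or> {v, pt (g + 2 * int h) (l - 1)} \<in> T"
        using two_families(2)[OF T'(1-3)] others T' by blast
      then show "T \<in> {T \<in> \<T>. {v, pt g 0} \<in> T} \<union> {T \<in> \<T>. {v, pt (g + 2 * int h) (l - 1)} \<in> T}"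
        using T'(1) by blast
    qed
    then have "card (trees_at g \<inter> trees_at (g + int h)) \<le>
        card ({T \<in> \<T>. {v, pt g 0} \<in> T} \<union> {T \<in> \<T>. {v, pt (g + 2 * int h) (l - 1)} \<in> T})"
      using finite_\<T> by (intro card_mono) auto
    also have "\<dots> \<le> 1 + 1"
      using card_Un_le add_mono[OF card_trees_containing card_trees_containing] by (rule le_trans)
    finally show ?thesis by simp
  qed
  \<comment> \<open>A tree other than \<open>T0\<close> has two diagonals with starting groups
    \<open>h\<close> apart, so its other diagonal starts at \<open>g - int h\<close> or at
    \<open>g + int h\<close>.\<close>
  have cover: "trees_at g \<subseteq> (trees_at (g - int h) \<inter> trees_at g) \<union> (trees_at g \<inter> trees_at (g + int h))"
    if g: "\<not> g \<cong> g0" for g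
  proof
    fix T assume T: "T \<in> trees_at g"
    then have T': "T \<in> \<T>" "T \<noteq> T0" using T0(3) g by (auto simp: trees_at_def)
    obtain g' where g': "T \<in> trees_at g'" "T \<in> trees_at (g' + int h)"
      "T \<inter> Diags = (T \<inter> diags_at g') \<union> (T \<inter> diags_at (g' + int h))"
      using two_diags[of T] T' others by blast
    have "T \<inter> diags_at g \<noteq> {}" using T by (simp add: trees_at_def)
    then consider "diags_at g' \<inter> diags_at g \<noteq> {}" | "diags_at (g' + int h) \<inter> diags_at g \<noteq> {}"
      using g'(3) diags_at_subset[of g] by blast
    then show "T \<in> (trees_at (g - int h) \<inter> trees_at g) \<union> (trees_at g \<inter> trees_at (g + int h))"
    proof cases
      case 1
      then have "g' \<cong> g" using diags_disjoint by blast
      then have "trees_at (g' + int h) = trees_at (g + int h)" by (intro trees_at_cong) simp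
      then show ?thesis using T g' by simp
    next
      case 2
      then have "g' + int h \<cong> g" using diags_disjoint by blast
      then have "trees_at g' = trees_at (g - int h)"
        by (intro trees_at_cong) (simp add: algebra_simps)
      then show ?thesis using T g' by simp
    qed
  qed
  let ?A = "trees_at (g0 - int h) \<inter> trees_at g0" and ?B = "trees_at g0 \<inter> trees_at (g0 + int h)"
  have nm: "\<not> g0 - int h \<cong> g0" "\<not> g0 + int h \<cong> g0" "\<not> g0 + 2 * int h \<cong> g0"
    using half_turn_neq(1)[of "g0 - int h"] half_turn_neq(2,4)[of g0] by simp_all
  have A: "l \<le> 2 + card ?A"
  proof -
    have "card (trees_at (g0 - 2 * int h) \<inter> trees_at (g0 - int h)) \<le> 2"
    proof -
      have eq: "g0 - 2 * int h + int h = g0 - int h" by simp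
      \<comment> \<open>Up to a full turn, \<open>g0 - int h\<close> has offset \<open>h + 1\<close>
        from \<open>g0\<close>, the first one at which \<open>T0\<close> owns all spokes.\<close>
      have "g0 - int h - (g0 + int (h + 1)) = - int k" using k_eq by simp
      then have "g0 - int h \<cong> g0 + int (h + 1)" by simp
      then show ?thesis
        using apex[of "h + 1" "g0 - 2 * int h", unfolded eq] nm(1) k_eq h_pos by linarith
    qed
    moreover have "card (trees_at (g0 - int h)) \<le>
        card (trees_at (g0 - 2 * int h) \<inter> trees_at (g0 - int h)) + card ?A"
    proof -
      have "trees_at (g0 - int h) \<subseteq> (trees_at (g0 - 2 * int h) \<inter> trees_at (g0 - int h)) \<union> ?A"
        using cover[OF nm(1)] by (simp add: algebra_simps)
      then have "card (trees_at (g0 - int h)) \<le>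
          card ((trees_at (g0 - 2 * int h) \<inter> trees_at (g0 - int h)) \<union> ?A)"
        using finite_trees by (intro card_mono) auto
      then show ?thesis using card_Un_le by (rule le_trans)
    qed
    ultimately show ?thesis using card_trees_at[of "g0 - int h"] by linarith
  qed
  have B: "l \<le> 2 + card ?B"
  proof -
    have "card (trees_at (g0 + int h) \<inter> trees_at (g0 + 2 * int h)) \<le> 2"
    proof -
      have eq: "g0 + int h + int h = g0 + 2 * int h" by simp
      have "g0 + 2 * int h \<cong> g0 + int (2 * h)" by simp
      then show ?thesis
        using apex[of "2 * h" "g0 + int h", unfolded eq] nm(3) k_eq h_pos by linarith
    qed
    moreover have "card (trees_at (g0 + int h)) \<le>
        card ?B + card (trees_at (g0 + int h) \<inter> trees_at (g0 + 2 * int h))"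
    proof -
      have "trees_at (g0 + int h) \<subseteq> ?B \<union> (trees_at (g0 + int h) \<inter> trees_at (g0 + 2 * int h))"
        using cover[OF nm(2)] by (simp add: algebra_simps)
      then have "card (trees_at (g0 + int h)) \<le>
          card (?B \<union> (trees_at (g0 + int h) \<inter> trees_at (g0 + 2 * int h)))"
        using finite_trees by (intro card_mono) auto
      then show ?thesis using card_Un_le by (rule le_trans)
    qed
    ultimately show ?thesis using card_trees_at[of "g0 + int h"] by linarith
  qed
  \<comment> \<open>A common tree would have families at \<open>g0 - int h\<close>,
    \<open>g0\<close> and \<open>g0 + int h\<close>, which are three different groups.\<close>
  have "?A \<inter> ?B = {}"
  proof (rule ccontr)
    assume "?A \<inter> ?B \<noteq> {}"
    then obtain T where T: "T \<in> trees_at (g0 - int h)" "T \<in> trees_at g0" "T \<in> trees_at (g0 + int h)"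
      by blast
    then have "T \<in> \<T>" "fam T (g0 - int h) \<noteq> {}" "fam T (g0 - int h + int h) \<noteq> {}"
      "fam T (g0 + int h) \<noteq> {}"
      using trees_atD by simp_all
    then have "g0 + int h \<cong> g0 - int h \<or> g0 + int h \<cong> g0 - int h + int h"
      by (rule third_family)
    then show False using half_turn_neq(4)[of "g0 - int h"] nm by (simp add: algebra_simps)
  qed
  moreover have "T0 \<notin> ?A \<union> ?B" using T0(3) nm by blast
  ultimately have "card (insert T0 (?A \<union> ?B)) = 1 + card ?A + card ?B"
    using finite_trees by (simp add: card_Un_disjoint)
  moreover have "card (insert T0 (?A \<union> ?B)) \<le> card (trees_at g0)"
    using T0(2) finite_trees by (intro card_mono) auto
  ultimately show False using A B l card_trees_at[of g0] by linarith
qed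

end

subsection \<open>Points in convex position around a centre\<close>

text \<open>Signed area of the parallelogram spanned by \<open>u\<close> and \<open>w\<close>:
  positive iff \<open>w\<close> lies less than a half turn counterclockwise of
  \<open>u\<close>.\<close>

definition cross :: "complex \<Rightarrow> complex \<Rightarrow> real" where
  "cross u w = Re u * Im w - Im u * Re w"

lemma cross_self [simp]: "cross u u = 0" by (simp add: cross_def)
lemma cross_zero [simp]: "cross 0 u = 0" "cross u 0 = 0" by (simp_all add: cross_def)
lemma cross_commute: "cross w u = - cross u w" by (simp add: cross_def)

lemma cross_conv_Im: "cross u w = Im (cnj u * w)" by (simp add: cross_def)

lemma abs_cross_le:
  assumes "norm u \<le> a" "norm w \<le> b"
  shows "\<bar>cross u w\<bar> \<le> a * b"
proof -
  have "\<bar>cross u w\<bar> \<le> norm u * norm w"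
    unfolding cross_conv_Im using abs_Im_le_cmod[of "cnj u * w"] by (simp add: norm_mult)
  also have "\<dots> \<le> a * b" using assms by (intro mult_mono) (auto intro: order_trans[OF norm_ge_zero])
  finally show ?thesis .
qed

lemma cross_rotate: "norm n = 1 \<Longrightarrow> cross (n * u) (n * w) = cross u w"
proof -
  assume n: "norm n = 1"
  have "cnj (n * u) * (n * w) = (cnj n * n) * (cnj u * w)" by simp
  also have "cnj n * n = 1" using n by (simp add: complex_norm_square[symmetric] mult.commute)
  finally have "cnj (n * u) * (n * w) = cnj u * w" by simp
  then show ?thesis unfolding cross_conv_Im by (simp only:)
qed

text \<open>The ends of each segment lie strictly on opposite sides of the other line. Cramer's rule
  gives the parameters \<open>s\<close> and \<open>t\<close> of the intersection point, and the
  signs put them strictly between 0 and 1.\<close>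

lemma open_segments_meet:
  assumes "cross (b - a) (c - a) < 0" "0 < cross (b - a) (d - a)"
    and "0 < cross (d - c) (a - c)" "cross (d - c) (b - c) < 0"
  shows "open_segment a b \<inter> open_segment c d \<noteq> {}"
proof -
  define D where "D = cross (b - a) (d - c)"
  define s where "s = cross (d - c) (a - c) / D"
  define t where "t = - cross (b - a) (c - a) / D"
  have D1: "D = cross (b - a) (d - a) - cross (b - a) (c - a)"
    and D2: "D = cross (d - c) (a - c) - cross (d - c) (b - c)"
    by (simp_all add: D_def cross_def algebra_simps)
  have D: "D > 0" using D1 assms by simp
  have st: "0 < s" "s < 1" "0 < t" "t < 1"
    using assms D D1 D2 by (simp_all add: s_def t_def field_simps)
  have sD: "D * s = cross (d - c) (a - c)" and tD: "D * t = - cross (b - a) (c - a)"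
    using D by (simp_all add: s_def t_def)
  have "D * (Re a + s * (Re b - Re a)) = D * (Re c + t * (Re d - Re c))"
    using arg_cong[OF sD, of "\<lambda>x. x * (Re b - Re a)"] arg_cong[OF tD, of "\<lambda>x. x * (Re d - Re c)"]
    unfolding D_def cross_def by (simp add: algebra_simps)
  moreover have "D * (Im a + s * (Im b - Im a)) = D * (Im c + t * (Im d - Im c))"
    using arg_cong[OF sD, of "\<lambda>x. x * (Im b - Im a)"] arg_cong[OF tD, of "\<lambda>x. x * (Im d - Im c)"]
    unfolding D_def cross_def by (simp add: algebra_simps)
  ultimately have "Re a + s * (Re b - Re a) = Re c + t * (Re d - Re c)"
    "Im a + s * (Im b - Im a) = Im c + t * (Im d - Im c)"
    using D by (simp_all only: mult_cancel_left) auto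
  then have eq: "(1 - s) *\<^sub>R a + s *\<^sub>R b = (1 - t) *\<^sub>R c + t *\<^sub>R d"
    by (simp add: complex_eq_iff algebra_simps)
  have "a \<noteq> b" "c \<noteq> d" using assms by auto
  then have "(1 - s) *\<^sub>R a + s *\<^sub>R b \<in> open_segment a b" "(1 - t) *\<^sub>R c + t *\<^sub>R d \<in> open_segment c d"
    using st by (auto simp: in_segment)
  then show ?thesis using eq by auto
qed

lemma rel_interior_edge:
  fixes a b :: "'a::euclidean_space"
  shows "a \<noteq> b \<Longrightarrow> rel_interior (convex hull {a, b}) = open_segment a b"
  by (simp add: segment_convex_hull[symmetric] rel_interior_closed_segment)

section \<open>Crossings forced by convex position\<close>

locale convex_wheel =
  fixes v :: complex and H :: "complex set"
  assumes extreme: "p \<in> H \<Longrightarrow> p extreme_point_of (convex hull (insert v H))"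
begin

definition ccw :: "complex \<Rightarrow> complex \<Rightarrow> bool" where "ccw p q \<longleftrightarrow> 0 < cross (p - v) (q - v)"

lemma ccw_neq: "ccw p q \<Longrightarrow> p \<noteq> v \<and> q \<noteq> v \<and> p \<noteq> q"
  by (auto simp: ccw_def)

lemma ccw_asym: "ccw p q \<Longrightarrow> \<not> ccw q p"
  using cross_commute[of "p - v" "q - v"] by (simp add: ccw_def)

lemma wedge_coefficients:
  "cross a b *\<^sub>R w = cross w b *\<^sub>R a + cross a w *\<^sub>R b"
  by (simp add: complex_eq_iff cross_def algebra_simps)

text \<open>An extreme point in the angle between \<open>a\<close> and \<open>b\<close> lies beyond the chord from \<open>a\<close> to \<open>b\<close>.\<close>

lemma wedge_beyond:
  assumes H: "a \<in> H" "w \<in> H" "b \<in> H" and c: "ccw a w" "ccw w b" "ccw a b"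
  shows "cross (a - v) (b - v) < cross (a - v) (w - v) + cross (w - v) (b - v)"
proof (rule ccontr)
  assume n: "\<not> ?thesis"
  let ?D = "cross (a - v) (b - v)"
  define \<alpha> where "\<alpha> = cross (w - v) (b - v) / ?D"
  define \<beta> where "\<beta> = cross (a - v) (w - v) / ?D"
  have D: "?D > 0" using c by (simp add: ccw_def)
  have pos: "0 \<le> \<alpha>" "0 \<le> \<beta>" using c D by (simp_all add: \<alpha>_def \<beta>_def ccw_def)
  \<comment> \<open>Otherwise \<open>w\<close> is a convex combination of \<open>v\<close>,
    \<open>a\<close> and \<open>b\<close>; being extreme, it would have to be one of these three
    points.\<close>
  have "\<alpha> + \<beta> \<le> 1" using n D by (simp add: \<alpha>_def \<beta>_def add_divide_distrib[symmetric] add.commute)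
  moreover have "?D *\<^sub>R (w - v) = ?D *\<^sub>R (\<alpha> *\<^sub>R (a - v) + \<beta> *\<^sub>R (b - v))"
    using wedge_coefficients[of "a - v" "b - v" "w - v"] D
    by (simp add: \<alpha>_def \<beta>_def scaleR_right_distrib)
  then have "w - v = \<alpha> *\<^sub>R (a - v) + \<beta> *\<^sub>R (b - v)" using D by simp
  then have "w = (1 - \<alpha> - \<beta>) *\<^sub>R v + \<alpha> *\<^sub>R a + \<beta> *\<^sub>R b"
    by (simp add: algebra_simps)
  ultimately have "w \<in> convex hull {v, a, b}"
    unfolding convex_hull_3 using pos
    by (intro CollectI exI[of _ "1 - \<alpha> - \<beta>"] exI[of _ \<alpha>] exI[of _ \<beta>]) auto
  moreover have "convex hull {v, a, b} \<subseteq> convex hull (insert v H)"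
    using H by (intro hull_mono) auto
  ultimately have "w extreme_point_of (convex hull {v, a, b})"
    using extreme[OF H(2)] unfolding extreme_point_of_def by blast
  then have "w \<in> {v, a, b}" by (rule extreme_point_of_convex_hull)
  then show False using c ccw_neq by blast
qed

lemma orient_conv: "cross (q - p) (s - p) =
    cross (p - v) (q - v) + cross (q - v) (s - v) + cross (s - v) (p - v)"
  by (simp add: cross_def algebra_simps)

text \<open>Split the signed area of the triangle into three triangles at \<open>v\<close>. If
  \<open>s\<close> is not counterclockwise of \<open>p\<close>, no term is negative and two are
  positive; otherwise \<open>wedge_beyond\<close> applies.\<close>

lemma orient_pos:
  assumes H: "p \<in> H" "q \<in> H" "s \<in> H" and c: "ccw p q" "ccw q s"
  shows "0 < cross (q - p) (s - p)"
proof (cases "ccw p s")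
  case True
  then show ?thesis
    using wedge_beyond[OF H c] cross_commute[of "p - v" "s - v"] orient_conv[of q p s] by linarith
next
  case False
  then show ?thesis
    using c cross_commute[of "p - v" "s - v"] orient_conv[of q p s] unfolding ccw_def by linarith
qed

text \<open>The triples \<open>a c b\<close>, \<open>a b d\<close>, \<open>a c d\<close> and
  \<open>c b d\<close> are all counterclockwise by \<open>orient_pos\<close>, which gives the four
  side conditions for crossing segments.\<close>

lemma chords_cross:
  assumes H: "a \<in> H" "b \<in> H" "c \<in> H" "d \<in> H"
    and o: "ccw a c" "ccw c b" "ccw a b" "ccw b d" "ccw c d"
  shows "open_segment a b \<inter> open_segment c d \<noteq> {}"
proof (rule open_segments_meet)
  show "cross (b - a) (c - a) < 0"
    using orient_pos[of a c b] H o cross_commute[of "c - a" "b - a"] by simp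
  show "0 < cross (b - a) (d - a)" using orient_pos[of a b d] H o by simp
  have "cross (d - c) (a - c) = cross (c - a) (d - a)" by (simp add: cross_def algebra_simps)
  then show "0 < cross (d - c) (a - c)" using orient_pos[of a c d] H o by simp
  show "cross (d - c) (b - c) < 0"
    using orient_pos[of c b d] H o cross_commute[of "b - c" "d - c"] by simp
qed

text \<open>By \<open>wedge_beyond\<close>, the chord separates \<open>w\<close> from
  \<open>v\<close>, while the spoke's line separates \<open>a\<close> from \<open>b\<close>. The
  spoke is reversed to fit the orientation in \<open>open_segments_meet\<close>.\<close>

lemma spoke_crosses:
  assumes H: "a \<in> H" "w \<in> H" "b \<in> H" and c: "ccw a w" "ccw w b" "ccw a b"
  shows "open_segment a b \<inter> open_segment v w \<noteq> {}"
proof -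
  have "open_segment a b \<inter> open_segment w v \<noteq> {}"
  proof (rule open_segments_meet)
    show "cross (b - a) (w - a) < 0"
      using wedge_beyond[OF H c] cross_commute[of "b - v" "a - v"] cross_commute[of "b - a" "w - a"]
        orient_conv[of w a b] by linarith
    have "cross (b - a) (v - a) = cross (a - v) (b - v)"
      "cross (v - w) (a - w) = cross (a - v) (w - v)"
      "cross (v - w) (b - w) = - cross (w - v) (b - v)"
      by (simp_all add: cross_def algebra_simps)
    then show "0 < cross (b - a) (v - a)" "0 < cross (v - w) (a - w)" "cross (v - w) (b - w) < 0"
      using c by (simp_all add: ccw_def)
  qed
  then show ?thesis by (simp add: open_segment_commute)
qed

end

subsection \<open>Small perturbations of a regular polygon\<close>

lemma enumerate_by_key:
  fixes key :: "'a \<Rightarrow> real"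
  assumes S: "finite S" and inj: "inj_on key S"
  obtains f where "bij_betw f {..<card S} S" "\<forall>i j. i < j \<longrightarrow> j < card S \<longrightarrow> key (f i) < key (f j)"
proof -
  define ks where "ks = sorted_list_of_set (key ` S)"
  have len: "length ks = card S" using card_image[OF inj] by (simp add: ks_def)
  have set: "set ks = key ` S" using S by (simp add: ks_def)
  define f where "f = inv_into S key \<circ> (!) ks"
  have "bij_betw ((!) ks) {..<card S} (key ` S)"
  proof (rule bij_betw_nth)
    show "distinct ks" by (simp add: ks_def)
  qed (simp_all only: len set)
  then have "bij_betw f {..<card S} S"
    unfolding f_def
    using bij_betw_inv_into[OF inj_on_imp_bij_betw[OF inj]] by (rule bij_betw_trans)
  moreover have "key (f i) < key (f j)" if "i < j" "j < card S" for i j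
  proof -
    have "key (f n) = ks ! n" if "n < card S" for n
      using that set len nth_mem[of n ks] by (simp add: f_def f_inv_into_f)
    moreover have "ks ! i < ks ! j"
    proof (rule sorted_wrt_nth_less)
      show "sorted_wrt (<) ks" by (simp add: ks_def)
    qed (use that len in simp_all)
    ultimately show ?thesis using that by simp
  qed
  ultimately show ?thesis using that by blast
qed

text \<open>Reducing the index changes the angle by full turns only, so arbitrary integers can index
  groups without wrap-around in angle differences.\<close>

lemma ngon_vertex_mod:
  assumes "0 < k"
  shows "ngon_vertex k v r \<phi> (nat (g mod int k)) = v + rcis r (\<phi> + 2 * pi * of_int g / real k)"
proof -
  have g: "real_of_int g = real (nat (g mod int k)) + real k * of_int (g div int k)"
  proof -
    have "g = int (nat (g mod int k)) + int k * (g div int k)" using assms by simp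
    then show ?thesis by (metis of_int_add of_int_mult of_int_of_nat_eq)
  qed
  have "\<phi> + 2 * pi * real (nat (g mod int k)) / real k =
      \<phi> + 2 * pi * of_int g / real k + 2 * pi * of_int (- (g div int k))"
    unfolding g using assms by (simp add: add_divide_distrib ring_distribs)
  then have "cis (\<phi> + 2 * pi * real (nat (g mod int k)) / real k) =
      cis (\<phi> + 2 * pi * of_int g / real k) * cis (2 * pi * of_int (- (g div int k)))"
    by (simp only: cis_mult)
  also have "cis (2 * pi * of_int (- (g div int k))) = 1" by (intro cis_multiple_2pi) simp
  finally show ?thesis by (simp add: ngon_vertex_def rcis_def)
qed

text \<open>The unperturbed product is \<open>r * (r * sin (\<beta> - \<alpha>))\<close>. Expanding
  bilinearly leaves three error terms of size at most \<open>r * \<epsilon>\<close> each, hence the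
  factor 3.\<close>

lemma cross_near_pos:
  assumes "norm (x - rcis r \<alpha>) \<le> \<epsilon>" "norm (y - rcis r \<beta>) \<le> \<epsilon>" "0 < r" "\<epsilon> \<le> r"
    and sin: "3 * \<epsilon> < r * sin (\<beta> - \<alpha>)"
  shows "0 < cross x y"
proof -
  define e f where "e = x - rcis r \<alpha>" and "f = y - rcis r \<beta>"
  have e: "norm e \<le> \<epsilon>" and f: "norm f \<le> \<epsilon>" using assms by (auto simp: e_def f_def)
  have "cross x y = cross (rcis r \<alpha>) (rcis r \<beta>) + cross (rcis r \<alpha>) f + cross e (rcis r \<beta>) + cross e f"
    by (simp add: e_def f_def cross_def algebra_simps)
  moreover have "cross (rcis r \<alpha>) (rcis r \<beta>) = r * (r * sin (\<beta> - \<alpha>))"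
    by (simp add: cross_def sin_diff algebra_simps)
  moreover have "\<bar>cross (rcis r \<alpha>) f\<bar> \<le> r * \<epsilon>"
    using f assms(3) by (intro abs_cross_le) auto
  moreover have "\<bar>cross e (rcis r \<beta>)\<bar> \<le> r * \<epsilon>"
    using abs_cross_le[OF e, of "rcis r \<beta>" r] assms(3) by (simp add: mult.commute)
  moreover have "\<bar>cross e f\<bar> \<le> r * \<epsilon>"
    using e f assms(4) by (intro abs_cross_le) auto
  moreover have "3 * (r * \<epsilon>) < r * (r * sin (\<beta> - \<alpha>))"
    using mult_strict_left_mono[OF sin assms(3)] by (simp add: mult.left_commute)
  ultimately show ?thesis by linarith
qed

lemma Re_rotate_pos:
  assumes "norm (x - rcis r \<alpha>) \<le> \<epsilon>" "\<epsilon> < r"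
  shows "0 < Re (cis (- \<alpha>) * x)"
proof -
  have eq: "cis (- \<alpha>) * x - of_real r = cis (- \<alpha>) * (x - rcis r \<alpha>)"
    by (simp add: rcis_def algebra_simps cis_mult)
  have "norm (cis (- \<alpha>) * x - of_real r) \<le> \<epsilon>"
    unfolding eq using assms by (simp add: norm_mult)
  with abs_Re_le_cmod have "\<bar>Re (cis (- \<alpha>) * x - of_real r)\<bar> \<le> \<epsilon>" by (rule order_trans)
  then show ?thesis using assms by simp
qed

lemma cross_pos_iff_slope_less:
  assumes "0 < Re z" "0 < Re w"
  shows "0 < cross z w \<longleftrightarrow> Im z / Re z < Im w / Re w"
  using assms by (simp add: cross_def field_simps)

lemma slope_eq_imp_collinear:
  assumes "Re z \<noteq> 0" "Im z / Re z = Im w / Re w" "Re w \<noteq> 0"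
  shows "collinear {0, z, w}"
proof -
  have "w = (Re w / Re z) *\<^sub>R z"
    using assms by (simp add: complex_eq_iff field_simps)
  then show ?thesis by (auto simp: collinear_lemma)
qed

text \<open>Rotating the group's direction to the positive real axis puts its points into the right
  half plane, where slope orders them by angle. Equal slopes would make two points collinear with
  \<open>v\<close>, against general position.\<close>

lemma enumerate_group:
  assumes near: "\<And>p. p \<in> S \<Longrightarrow> norm (p - v - rcis r \<alpha>) \<le> \<epsilon>" and \<epsilon>: "\<epsilon> < r"
    and card: "card S = l" and l: "0 < l"
    and gen: "general_position V" and SV: "insert v S \<subseteq> V"
  obtains f where "bij_betw f {..<l} S"
    "\<forall>x y. x < y \<longrightarrow> y < l \<longrightarrow> 0 < cross (f x - v) (f y - v)"
proof -
  let ?z = "\<lambda>p. cis (- \<alpha>) * (p - v)"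
  let ?key = "\<lambda>p. Im (?z p) / Re (?z p)"
  have pos: "0 < Re (?z p)" if "p \<in> S" for p
    using near[OF that] \<epsilon> by (rule Re_rotate_pos)
  have fin: "finite S" using card l card_ge_0_finite by blast
  have inj: "inj_on ?key S"
  proof (rule inj_onI, rule ccontr)
    fix p q assume p: "p \<in> S" and q: "q \<in> S" and eq: "?key p = ?key q" and "p \<noteq> q"
    have "p \<noteq> v" "q \<noteq> v" using pos[OF p] pos[OF q] by auto
    have "collinear {0, ?z p, ?z q}"
      using pos[OF p] pos[OF q] eq by (intro slope_eq_imp_collinear) auto
    then obtain c where "?z q = c *\<^sub>R ?z p"
      using \<open>p \<noteq> v\<close> \<open>q \<noteq> v\<close> by (auto simp: collinear_lemma)
    then have "cis (- \<alpha>) * (q - v) = cis (- \<alpha>) * (c *\<^sub>R (p - v))" by simp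
    then have "q - v = c *\<^sub>R (p - v)" by (simp only: mult_cancel_left) simp
    then have "collinear {0, p - v, q - v}" unfolding collinear_lemma by blast
    then have "collinear {p, v, q}" by (simp add: collinear_3)
    moreover have "card {p, v, q} = 3" "{p, v, q} \<subseteq> V"
      using \<open>p \<noteq> q\<close> \<open>p \<noteq> v\<close> \<open>q \<noteq> v\<close> p q SV by auto
    ultimately show False using gen unfolding general_position_def by blast
  qed
  obtain f where f: "bij_betw f {..<card S} S"
    and mono: "\<forall>x y. x < y \<longrightarrow> y < card S \<longrightarrow> ?key (f x) < ?key (f y)"
    by (rule enumerate_by_key[OF fin inj])
  have "0 < cross (f x - v) (f y - v)" if "x < y" "y < l" for x y
  proof -
    have "f x \<in> S" "f y \<in> S" using f that card by (auto simp: bij_betw_def)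
    then have "0 < cross (?z (f x)) (?z (f y))"
      using mono that card pos by (simp only: cross_pos_iff_slope_less)
    then show ?thesis by (simp add: cross_rotate)
  qed
  then show ?thesis using that f card by simp
qed

section \<open>Instantiating the combinatorial argument with a bumpy wheel\<close>

lemma plane_edges_disjoint:
  assumes "plane_edges E" "{a, b} \<in> E" "{c, d} \<in> E" "{a, b} \<noteq> {c, d}" "a \<noteq> b" "c \<noteq> d"
  shows "open_segment a b \<inter> open_segment c d = {}"
  using assms unfolding plane_edges_def by (metis rel_interior_edge)

theorem theorem5:
  fixes k l :: nat and v :: complex and r \<phi> :: real
  assumes "odd k" and "k \<ge> 3" and "odd l" and "l \<ge> 5" and "r > 0"
  shows "\<exists>\<epsilon>\<^sub>0>0. \<forall>\<epsilon>. 0 < \<epsilon> \<and> \<epsilon> < \<epsilon>\<^sub>0 \<longrightarrow>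
           (\<forall>G. bumpy_wheel k l v r \<phi> \<epsilon> G \<longrightarrow>
              \<not> (\<exists>\<T>. partition_on (complete_edges (bumpy_wheel_points k v G)) \<T> \<and>
                      card \<T> = (k * l + 1) div 2 \<and>
                      (\<forall>T\<in>\<T>. plane_spanning_tree (bumpy_wheel_points k v G) T)))"
proof -
  obtain h where k: "k = 2 * h + 1" and h: "1 \<le> h"
    using assms(1,2) by (elim oddE) auto
  define s where "s t = sin (2 * pi * real t / real k)" for t
  \<comment> \<open>The smallest sine of an angle between groups at most \<open>h\<close> apart. All
    these angles are below a half turn since \<open>2 * t < k\<close>.\<close>
  define m where "m = Min (s ` {1..h})"
  have "0 < s t" if "t \<in> {1..h}" for t
    unfolding s_def
  proof (rule sin_gt_zero)
    show "0 < 2 * pi * real t / real k" using that k by simp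
    have "2 * real t < real k" using that k by simp
    then have "pi * (2 * real t) < pi * real k" by (intro mult_strict_left_mono) auto
    then show "2 * pi * real t / real k < pi" using k by (simp add: field_simps)
  qed
  then have m_pos: "0 < m" using h by (simp add: m_def)
  have m_le: "m \<le> s t" if "t \<in> {1..h}" for t using that by (simp add: m_def)
  have m_le1: "m \<le> 1" using m_le[of 1] h sin_le_one by (force simp: s_def intro: order_trans)
  show ?thesis
  \<comment> \<open>This threshold is what \<open>cross_near_pos\<close> needs for all offsets at
    once; with \<open>m \<le> 1\<close> it also yields \<open>\<epsilon> < r\<close>.\<close>
  proof (intro exI[of _ "r * m / 3"] conjI allI impI notI)
    show "0 < r * m / 3" using assms m_pos by simp
    fix \<epsilon> G assume "0 < \<epsilon> \<and> \<epsilon> < r * m / 3"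
    then have \<epsilon>: "0 < \<epsilon>" "3 * \<epsilon> < r * m" by auto
    have "r * m \<le> r * 1" using m_le1 assms by (intro mult_left_mono) auto
    then have \<epsilon>r: "\<epsilon> < r" using \<epsilon> by linarith
    let ?V = "bumpy_wheel_points k v G"
    define H where "H = (\<Union>i<k. G i)"
    have V: "?V = insert v H" by (simp add: bumpy_wheel_points_def H_def)
    assume "bumpy_wheel k l v r \<phi> \<epsilon> G"
    then have cardG: "\<And>i. i < k \<Longrightarrow> card (G i) = l"
      and cballG: "\<And>i. i < k \<Longrightarrow> G i \<subseteq> cball (ngon_vertex k v r \<phi> i) \<epsilon>"
      and disj: "disjoint_family_on G {..<k}" and gen: "general_position ?V"
      and ext: "\<And>i p. i < k \<Longrightarrow> p \<in> G i \<Longrightarrow> p extreme_point_of (convex hull ?V)"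
      unfolding bumpy_wheel_def Let_def by auto
    interpret convex_wheel v H
      using ext by unfold_locales (auto simp: V H_def)
    define ix where "ix g = nat (g mod int k)" for g
    have ix: "ix g < k" for g using k by (simp add: ix_def nat_less_iff)
    have near: "norm (p - v - rcis r (\<phi> + 2 * pi * of_int g / real k)) \<le> \<epsilon>"
      if "p \<in> G (ix g)" for p g
    proof -
      have "p \<in> cball (ngon_vertex k v r \<phi> (ix g)) \<epsilon>" using that cballG[OF ix] by blast
      moreover have "ngon_vertex k v r \<phi> (ix g) = v + rcis r (\<phi> + 2 * pi * of_int g / real k)"
        unfolding ix_def using assms(2) by (intro ngon_vertex_mod) simp
      ultimately have "dist (v + rcis r (\<phi> + 2 * pi * of_int g / real k)) p \<le> \<epsilon>" by simp
      then show ?thesis by (simp add: dist_norm norm_minus_commute algebra_simps)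
    qed
    have "\<exists>f. bij_betw f {..<l} (G i) \<and>
        (\<forall>x y. x < y \<longrightarrow> y < l \<longrightarrow> 0 < cross (f x - v) (f y - v))" if i: "i < k" for i
    proof -
      have "ix (int i) = i" using i by (simp add: ix_def)
      then have near_i: "norm (p - v - rcis r (\<phi> + 2 * pi * of_int (int i) / real k)) \<le> \<epsilon>"
        if "p \<in> G i" for p
        using near[of p "int i"] that by simp
      have "0 < l" "insert v (G i) \<subseteq> ?V" using i assms(4) by (auto simp: V H_def)
      then obtain f where "bij_betw f {..<l} (G i)"
        "\<forall>x y. x < y \<longrightarrow> y < l \<longrightarrow> 0 < cross (f x - v) (f y - v)"
        using enumerate_group[OF near_i \<epsilon>r cardG[OF i] _ gen] by blast
      then show ?thesis by blast
    qed
    then obtain f where bij: "\<And>i. i < k \<Longrightarrow> bij_betw (f i) {..<l} (G i)"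
      and mono: "\<And>i x y. i < k \<Longrightarrow> x < y \<Longrightarrow> y < l \<Longrightarrow> 0 < cross (f i x - v) (f i y - v)"
      by metis
    define pt where "pt g x = f (ix g) x" for g x
    have pt_in: "pt g x \<in> G (ix g)" if "x < l" for g x
      using bij[OF ix, of g] that by (auto simp: pt_def bij_betw_def)
    have H_eq: "{pt g x |g x. x < l} = H"
    proof
      show "{pt g x |g x. x < l} \<subseteq> H" using pt_in ix by (auto simp: H_def)
      show "H \<subseteq> {pt g x |g x. x < l}"
      proof
        fix p assume "p \<in> H"
        then obtain i where i: "i < k" "p \<in> G i" by (auto simp: H_def)
        then obtain x where "x < l" "p = f i x" using bij[OF i(1)] by (auto simp: bij_betw_def)
        moreover have "ix (int i) = i" using i by (simp add: ix_def)
        ultimately have "p = pt (int i) x" by (simp add: pt_def)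
        then show "p \<in> {pt g x |g x. x < l}" using \<open>x < l\<close> by blast
      qed
    qed
    assume "\<exists>\<T>. partition_on (complete_edges ?V) \<T> \<and> card \<T> = (k * l + 1) div 2 \<and>
      (\<forall>T\<in>\<T>. plane_spanning_tree ?V T)"
    then obtain \<T> where part: "partition_on (complete_edges (insert v H)) \<T>"
      and card: "card \<T> = (k * l + 1) div 2"
      and trees: "\<And>T. T \<in> \<T> \<Longrightarrow> plane_spanning_tree (insert v H) T"
      unfolding V by blast
    have ends: "a \<in> insert v H" "b \<in> insert v H" if "T \<in> \<T>" "{a, b} \<in> T" for T a b
      using trees[OF that(1)] that(2)
      by (auto simp: plane_spanning_tree_def spanning_tree_def complete_edges_def)
    have plane: "plane_edges T" if "T \<in> \<T>" for T
      using trees[OF that] by (simp add: plane_spanning_tree_def)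
    have "wheel_forests k l h pt v ccw \<T>"
    proof
      show "k = 2 * h + 1" "1 \<le> h" "0 < l" using k h assms by auto
      show "pt g x = pt g' y \<longleftrightarrow> g mod int k = g' mod int k \<and> x = y"
        if "x < l" "y < l" for x y g g'
      proof
        assume eq: "pt g x = pt g' y"
        have "ix g = ix g'"
        proof (rule ccontr)
          assume "ix g \<noteq> ix g'"
          then have "G (ix g) \<inter> G (ix g') = {}"
            using disj ix by (simp add: disjoint_family_on_def)
          then show False using pt_in[OF that(1), of g] pt_in[OF that(2), of g'] eq by auto
        qed
        then show "g mod int k = g' mod int k \<and> x = y"
          using eq that bij[OF ix, of g] k
          by (auto simp: pt_def bij_betw_def inj_on_def ix_def eq_nat_nat_iff)
      qed (simp add: pt_def ix_def)
      show "pt g x \<noteq> v" if "x < l" for x g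
        using Re_rotate_pos[OF near[OF pt_in[OF that, of g]] \<epsilon>r] by auto
      show "ccw (pt g x) (pt (g + t) y)" if "0 < t" "t \<le> int h" "x < l" "y < l" for t x y g
        unfolding ccw_def
      proof (rule cross_near_pos[OF near[OF pt_in] near[OF pt_in]])
        have "\<phi> + 2 * pi * of_int (g + t) / real k - (\<phi> + 2 * pi * of_int g / real k) =
            2 * pi * real (nat t) / real k"
          using that by (simp add: add_divide_distrib ring_distribs)
        moreover have "nat t \<in> {1..h}" using that by auto
        then have "r * m \<le> r * s (nat t)"
          using m_le assms(5) by (intro mult_left_mono) auto
        ultimately show "3 * \<epsilon> < r * sin (\<phi> + 2 * pi * of_int (g + t) / real k -
            (\<phi> + 2 * pi * of_int g / real k))"
          using \<epsilon> by (simp add: s_def)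
      qed (use that assms \<epsilon>r in auto)
      show "ccw (pt g x) (pt g y)" if "x < y" "y < l" for x y g
        using mono[OF ix that] by (simp add: ccw_def pt_def)
      show "partition_on (complete_edges (insert v {pt g x |g x. x < l})) \<T>"
        using part by (simp only: H_eq)
      \<comment> \<open>As \<open>k * l\<close> is odd, the division by 2 is exact.\<close>
      show "2 * card \<T> = k * l + 1" using card assms by simp
      show "\<not> graph_cycle T cyc" if "T \<in> \<T>" for T cyc
        using trees[OF that] by (simp add: plane_spanning_tree_def spanning_tree_def)
      show False if "T \<in> \<T>" "{a, b} \<in> T" "{c, d} \<in> T" "ccw a c" "ccw c b" "ccw a b" "ccw b d" "ccw c d"
        for T a b c d
      proof -
        \<comment> \<open>The \<open>ccw\<close> relations exclude \<open>v\<close> as an end, so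
          all four ends are hull points; asymmetry of \<open>ccw\<close> makes the two edges
          different.\<close>
        have "a \<in> H" "b \<in> H" "c \<in> H" "d \<in> H"
          using ends[OF that(1,2)] ends[OF that(1,3)] that(4-8) ccw_neq by blast+
        moreover have "{a, b} \<noteq> {c, d}"
          using that(4-8) ccw_neq ccw_asym by (auto simp: doubleton_eq_iff)
        ultimately show False
          using chords_cross[OF _ _ _ _ that(4-8)] ccw_neq[OF that(6)] ccw_neq[OF that(8)]
            plane_edges_disjoint[OF plane[OF that(1)] that(2,3)] by blast
      qed
      show False if "T \<in> \<T>" "{a, b} \<in> T" "{v, w} \<in> T" "ccw a w" "ccw w b" "ccw a b" for T a b w
      proof -
        have "a \<in> H" "w \<in> H" "b \<in> H"
          using ends[OF that(1,2)] ends[OF that(1,3)] that(4-6) ccw_neq by blast+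
        moreover have "{a, b} \<noteq> {v, w}" "v \<noteq> w"
          using that(4-6) ccw_neq by (auto simp: doubleton_eq_iff)
        ultimately show False
          using spoke_crosses[OF _ _ _ that(4-6)] ccw_neq[OF that(6)]
            plane_edges_disjoint[OF plane[OF that(1)] that(2,3)] by blast
      qed
    qed
    then show False using assms(4) by (rule wheel_forests.no_wheel_forests)
  qed
qed

end
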